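(* Let $\Lambda$ be any subset of the following six frame conditions, each paired with an axiom schema (here $w,v$ range over worlds, $s,t$ over sets of worlds, $wR_\Sigma v$ means $v\in\bigcup\Sigma(w)$, $\varphi,\psi$ range over arbitrary formulas and $\alpha$ over declaratives): (1) downward-monotonicity: $\emptyset\neq t\subseteq s\in\Sigma(w)\Rightarrow t\in\Sigma(w)$; axiom $(\varphi\Rrightarrow\psi)\to\boxplus(\varphi\to\psi)$; (2) finite union-closure: $s,t\in\Sigma(w)\Rightarrow s\cup t\in\Sigma(w)$; axiom $(\alpha\Rrightarrow\varphi\veebar\psi)\to(\alpha\Rrightarrow\varphi)\vee(\alpha\Rrightarrow\psi)$; (3) reflexivity: $w\in\bigcup\Sigma(w)$; axiom $\boxplus\alpha\to\alpha$; (4) non-triviality: $\Sigma(w)\neq\emptyset$; axiom $\neg\boxplus\bot$; (5) decreasingness: $wR_\Sigma v\Rightarrow\Sigma(w)\supseteq\Sigma(v)$; axiom $(\varphi\Rrightarrow\psi)\to\boxplus(\varphi\Rrightarrow\psi)$; (6) increasingness: $wR_\Sigma v\Rightarrow\Sigma(w)\subseteq\Sigma(v)$; axiom $\neg(\varphi\Rrightarrow\psi)\to\boxplus\neg(\varphi\Rrightarrow\psi)$. Let $\vdash_\Lambda$ be derivability in the proof system obtained by adding, as axioms, all instances of the schemata corresponding to the conditions in $\Lambda$, and let $\models_\Lambda$ be consequence over the class of in-models whose underlying frame $\langle W,\Sigma\rangle$ satisfies all conditions in $\Lambda$. Then for all $\Phi\cup\{\psi\}\subseteq\mathcal L_{\Rrightarrow}$: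 $\Phi\vdash_\Lambda\psi$ if and only if $\Phi\models_\Lambda\psi$.
   Context: Fix a set $\mathcal P$ of atoms. Formulas of $\mathcal L_{\Rrightarrow}$: $\varphi ::= p \mid \bot \mid (\varphi\wedge\varphi)\mid(\varphi\to\varphi)\mid(\varphi\veebar\varphi)\mid(\varphi\Rrightarrow\varphi)$, $p\in\mathcal P$, with $\veebar$ inquisitive disjunction; $\neg\varphi:=\varphi\to\bot$, $\top:=\neg\bot$, $\varphi\vee\psi:=\neg(\neg\varphi\wedge\neg\psi)$, $\boxplus\varphi:=(\top\Rrightarrow\varphi)$. A declarative is a formula in which every occurrence of $\veebar$ lies within an argument of some occurrence of $\Rrightarrow$. An in-model is $M=\langle W,\Sigma,V\rangle$ with $W$ nonempty, $\Sigma(w)$ a set of nonempty subsets of $W$ for each $w\in W$, $V:W\times\mathcal P\to\{0,1\}$; its frame is $\langle W,\Sigma\rangle$. Support at $s\subseteq W$: $M,s\models p$ iff $V(w,p)=1$ for all $w\in s$; $M,s\models\bot$ iff $s=\emptyset$; $\wedge$ conjunctively; $M,s\models\varphi\veebar\psi$ iff $M,s\models\varphi$ or $M,s\models\psi$; $M,s\models\varphi\to\psi$ iff for all $t\subseteq s$, $M,t\models\varphi$ implies $M,t\models\psi$; $M,s\models\varphi\Rrightarrow\psi$ iff for all $w\in s$ and $t\in\Sigma(w)$, $M,t\models\varphi$ implies $M,t\models\psi$. For a class of in-models, $\Phi\models\psi$ over the class means: for every in-model $M$ in the class and state $s$, if $M,s\models\varphi$ for all $\varphi\in\Phi$ then $M,s\models\psi$.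 Base proof system: axioms are all instances of the axioms of intuitionistic propositional logic with $\veebar$ as disjunction; (DDN) $\neg\neg\alpha\to\alpha$ and (Split) $(\alpha\to\varphi\veebar\psi)\to(\alpha\to\varphi)\veebar(\alpha\to\psi)$ for $\alpha$ declarative; (Trans) $(\varphi\Rrightarrow\psi)\wedge(\psi\Rrightarrow\chi)\to(\varphi\Rrightarrow\chi)$; (RConj) $(\varphi\Rrightarrow\psi)\wedge(\varphi\Rrightarrow\chi)\to(\varphi\Rrightarrow\psi\wedge\chi)$; (LDisj) $(\varphi\Rrightarrow\chi)\wedge(\psi\Rrightarrow\chi)\to(\varphi\veebar\psi\Rrightarrow\chi)$. Rules: modus ponens and conditional necessitation (from $\varphi\to\psi$ infer $\varphi\Rrightarrow\psi$). $\Phi\vdash\psi$ means some finite $\varphi_1,\dots,\varphi_n\in\Phi$ ($n\ge0$) have $(\varphi_1\wedge\dots\wedge\varphi_n)\to\psi$ derivable. *)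

theory Defs
  imports Main
begin

text \<open>In the object language \<open>\<^bold>\<squnion>\<close> is inquisitive disjunction (primitive), \<open>\<^bold>\<or>\<close> is the defined classical
  disjunction, \<open>\<Rrightarrow>\<close> is the neighbourhood conditional and \<open>\<^bold>\<box>\<close> its unary special case.\<close>

datatype 'p form =
    Atom 'p
  | Falsum  (\<open>\<^bold>\<bottom>\<close>)
  | Conj "'p form" "'p form"  (infixr \<open>\<^bold>\<and>\<close> 65)
  | Impl "'p form" "'p form"  (infixr \<open>\<^bold>\<rightarrow>\<close> 55)
  | InqDisj "'p form" "'p form"  (infixr \<open>\<^bold>\<squnion>\<close> 60)
  | Cond "'p form" "'p form"  (infix \<open>\<Rrightarrow>\<close> 58)

definition Neg :: "'p form \<Rightarrow> 'p form"  (\<open>\<^bold>\<not> _\<close> [70] 70) where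
  "\<^bold>\<not> \<phi> = (\<phi> \<^bold>\<rightarrow> \<^bold>\<bottom>)"

definition Verum :: "'p form"  (\<open>\<^bold>\<top>\<close>) where
  "\<^bold>\<top> = \<^bold>\<not> \<^bold>\<bottom>"

definition Disj :: "'p form \<Rightarrow> 'p form \<Rightarrow> 'p form"  (infixr \<open>\<^bold>\<or>\<close> 60) where
  "\<phi> \<^bold>\<or> \<psi> = \<^bold>\<not> (\<^bold>\<not> \<phi> \<^bold>\<and> \<^bold>\<not> \<psi>)"

definition Box :: "'p form \<Rightarrow> 'p form"  (\<open>\<^bold>\<box> _\<close> [70] 70) where
  "\<^bold>\<box> \<phi> = (\<^bold>\<top> \<Rrightarrow> \<phi>)"

primrec declarative :: "'p form \<Rightarrow> bool" where
  "declarative (Atom p) = True"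
| "declarative \<^bold>\<bottom> = True"
| "declarative (\<phi> \<^bold>\<and> \<psi>) = (declarative \<phi> \<and> declarative \<psi>)"
| "declarative (\<phi> \<^bold>\<rightarrow> \<psi>) = (declarative \<phi> \<and> declarative \<psi>)"
| "declarative (\<phi> \<^bold>\<squnion> \<psi>) = False"
| "declarative (\<phi> \<Rrightarrow> \<psi>) = True"

record 'w in_frame =
  worlds :: "'w set"
  nbhds :: "'w \<Rightarrow> 'w set set"

record ('w, 'p) in_model = "'w in_frame" +
  val :: "'w \<Rightarrow> 'p \<Rightarrow> bool"

text \<open>\<open>nbhds\<close> and \<open>val\<close> are unconstrained, and never consulted, outside \<open>worlds\<close>.\<close>

definition in_frame :: "('w, 'z) in_frame_scheme \<Rightarrow> bool" where
  "in_frame F \<longleftrightarrow>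
     worlds F \<noteq> {} \<and> (\<forall>w \<in> worlds F. \<forall>s \<in> nbhds F w. s \<noteq> {} \<and> s \<subseteq> worlds F)"

primrec supports :: "('w, 'p) in_model \<Rightarrow> 'w set \<Rightarrow> 'p form \<Rightarrow> bool" where
  "supports M s (Atom p) \<longleftrightarrow> (\<forall>w \<in> s. val M w p)"
| "supports M s \<^bold>\<bottom> \<longleftrightarrow> s = {}"
| "supports M s (\<phi> \<^bold>\<and> \<psi>) \<longleftrightarrow> supports M s \<phi> \<and> supports M s \<psi>"
| "supports M s (\<phi> \<^bold>\<rightarrow> \<psi>) \<longleftrightarrow> (\<forall>t. t \<subseteq> s \<longrightarrow> supports M t \<phi> \<longrightarrow> supports M t \<psi>)"
| "supports M s (\<phi> \<^bold>\<squnion> \<psi>) \<longleftrightarrow> supports M s \<phi> \<or> supports M s \<psi>"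
| "supports M s (\<phi> \<Rrightarrow> \<psi>) \<longleftrightarrow>
     (\<forall>w \<in> s. \<forall>t \<in> nbhds M w. supports M t \<phi> \<longrightarrow> supports M t \<psi>)"

datatype frame_condition =
    Downward_Monotonicity
  | Finite_Union_Closure
  | Reflexivity
  | Non_Triviality
  | Decreasingness
  | Increasingness

definition accessible :: "('w, 'z) in_frame_scheme \<Rightarrow> 'w \<Rightarrow> 'w \<Rightarrow> bool" where
  "accessible F w v \<longleftrightarrow> v \<in> \<Union> (nbhds F w)"

primrec satisfies :: "('w, 'z) in_frame_scheme \<Rightarrow> frame_condition \<Rightarrow> bool" where
  "satisfies F Downward_Monotonicity \<longleftrightarrow>
     (\<forall>w \<in> worlds F. \<forall>s t. t \<noteq> {} \<longrightarrow> t \<subseteq> s \<longrightarrow> s \<in> nbhds F w \<longrightarrow> t \<in> nbhds F w)"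
| "satisfies F Finite_Union_Closure \<longleftrightarrow>
     (\<forall>w \<in> worlds F. \<forall>s t. s \<in> nbhds F w \<longrightarrow> t \<in> nbhds F w \<longrightarrow> s \<union> t \<in> nbhds F w)"
| "satisfies F Reflexivity \<longleftrightarrow> (\<forall>w \<in> worlds F. w \<in> \<Union> (nbhds F w))"
| "satisfies F Non_Triviality \<longleftrightarrow> (\<forall>w \<in> worlds F. nbhds F w \<noteq> {})"
| "satisfies F Decreasingness \<longleftrightarrow>
     (\<forall>w \<in> worlds F. \<forall>v \<in> worlds F. accessible F w v \<longrightarrow> nbhds F v \<subseteq> nbhds F w)"
| "satisfies F Increasingness \<longleftrightarrow>
     (\<forall>w \<in> worlds F. \<forall>v \<in> worlds F. accessible F w v \<longrightarrow> nbhds F w \<subseteq> nbhds F v)"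

text \<open>HOL has no quantification over types inside formulas, so consequence is relative to a type
  \<open>'w\<close> from which the worlds are drawn; \<open>worlds M\<close> may be any nonempty subset of it.\<close>

definition entails ::
  "'w itself \<Rightarrow> frame_condition set \<Rightarrow> 'p form set \<Rightarrow> 'p form \<Rightarrow> bool" where
  "entails (T :: 'w itself) \<Lambda> \<Phi> \<psi> \<longleftrightarrow>
     (\<forall>(M :: ('w, 'p) in_model) s.
        in_frame M \<longrightarrow> (\<forall>c \<in> \<Lambda>. satisfies M c) \<longrightarrow> s \<subseteq> worlds M \<longrightarrow>
        (\<forall>\<phi> \<in> \<Phi>. supports M s \<phi>) \<longrightarrow> supports M s \<psi>)"

primrec schema :: "frame_condition \<Rightarrow> 'p form set" where
  "schema Downward_Monotonicity = {(\<phi> \<Rrightarrow> \<psi>) \<^bold>\<rightarrow> \<^bold>\<box> (\<phi> \<^bold>\<rightarrow> \<psi>) | \<phi> \<psi>. True}"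
| "schema Finite_Union_Closure =
     {(\<alpha> \<Rrightarrow> (\<phi> \<^bold>\<squnion> \<psi>)) \<^bold>\<rightarrow> ((\<alpha> \<Rrightarrow> \<phi>) \<^bold>\<or> (\<alpha> \<Rrightarrow> \<psi>)) | \<alpha> \<phi> \<psi>. declarative \<alpha>}"
| "schema Reflexivity = {\<^bold>\<box> \<alpha> \<^bold>\<rightarrow> \<alpha> | \<alpha>. declarative \<alpha>}"
| "schema Non_Triviality = {\<^bold>\<not> (\<^bold>\<box> \<^bold>\<bottom>)}"
| "schema Decreasingness = {(\<phi> \<Rrightarrow> \<psi>) \<^bold>\<rightarrow> \<^bold>\<box> (\<phi> \<Rrightarrow> \<psi>) | \<phi> \<psi>. True}"
| "schema Increasingness = {\<^bold>\<not> (\<phi> \<Rrightarrow> \<psi>) \<^bold>\<rightarrow> \<^bold>\<box> (\<^bold>\<not> (\<phi> \<Rrightarrow> \<psi>)) | \<phi> \<psi>. True}"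

inductive derivable :: "frame_condition set \<Rightarrow> 'p form \<Rightarrow> bool" for \<Lambda> where
  K: "derivable \<Lambda> (\<phi> \<^bold>\<rightarrow> (\<psi> \<^bold>\<rightarrow> \<phi>))"
| S: "derivable \<Lambda> ((\<phi> \<^bold>\<rightarrow> (\<psi> \<^bold>\<rightarrow> \<chi>)) \<^bold>\<rightarrow> ((\<phi> \<^bold>\<rightarrow> \<psi>) \<^bold>\<rightarrow> (\<phi> \<^bold>\<rightarrow> \<chi>)))"
| ConjI: "derivable \<Lambda> (\<phi> \<^bold>\<rightarrow> (\<psi> \<^bold>\<rightarrow> (\<phi> \<^bold>\<and> \<psi>)))"
| ConjE1: "derivable \<Lambda> ((\<phi> \<^bold>\<and> \<psi>) \<^bold>\<rightarrow> \<phi>)"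
| ConjE2: "derivable \<Lambda> ((\<phi> \<^bold>\<and> \<psi>) \<^bold>\<rightarrow> \<psi>)"
| InqDisjI1: "derivable \<Lambda> (\<phi> \<^bold>\<rightarrow> (\<phi> \<^bold>\<squnion> \<psi>))"
| InqDisjI2: "derivable \<Lambda> (\<psi> \<^bold>\<rightarrow> (\<phi> \<^bold>\<squnion> \<psi>))"
| InqDisjE: "derivable \<Lambda> ((\<phi> \<^bold>\<rightarrow> \<chi>) \<^bold>\<rightarrow> ((\<psi> \<^bold>\<rightarrow> \<chi>) \<^bold>\<rightarrow> ((\<phi> \<^bold>\<squnion> \<psi>) \<^bold>\<rightarrow> \<chi>)))"
| ExFalso: "derivable \<Lambda> (\<^bold>\<bottom> \<^bold>\<rightarrow> \<phi>)"
| DDN: "declarative \<alpha> \<Longrightarrow> derivable \<Lambda> (\<^bold>\<not> (\<^bold>\<not> \<alpha>) \<^bold>\<rightarrow> \<alpha>)"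
| Split: "declarative \<alpha> \<Longrightarrow>
    derivable \<Lambda> ((\<alpha> \<^bold>\<rightarrow> (\<phi> \<^bold>\<squnion> \<psi>)) \<^bold>\<rightarrow> ((\<alpha> \<^bold>\<rightarrow> \<phi>) \<^bold>\<squnion> (\<alpha> \<^bold>\<rightarrow> \<psi>)))"
| Trans: "derivable \<Lambda> (((\<phi> \<Rrightarrow> \<psi>) \<^bold>\<and> (\<psi> \<Rrightarrow> \<chi>)) \<^bold>\<rightarrow> (\<phi> \<Rrightarrow> \<chi>))"
| RConj: "derivable \<Lambda> (((\<phi> \<Rrightarrow> \<psi>) \<^bold>\<and> (\<phi> \<Rrightarrow> \<chi>)) \<^bold>\<rightarrow> (\<phi> \<Rrightarrow> (\<psi> \<^bold>\<and> \<chi>)))"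
| LDisj: "derivable \<Lambda> (((\<phi> \<Rrightarrow> \<chi>) \<^bold>\<and> (\<psi> \<Rrightarrow> \<chi>)) \<^bold>\<rightarrow> ((\<phi> \<^bold>\<squnion> \<psi>) \<Rrightarrow> \<chi>))"
| Schema: "c \<in> \<Lambda> \<Longrightarrow> \<phi> \<in> schema c \<Longrightarrow> derivable \<Lambda> \<phi>"
| MP: "derivable \<Lambda> (\<phi> \<^bold>\<rightarrow> \<psi>) \<Longrightarrow> derivable \<Lambda> \<phi> \<Longrightarrow> derivable \<Lambda> \<psi>"
| CondNec: "derivable \<Lambda> (\<phi> \<^bold>\<rightarrow> \<psi>) \<Longrightarrow> derivable \<Lambda> (\<phi> \<Rrightarrow> \<psi>)"

fun conj_list :: "'p form list \<Rightarrow> 'p form" where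
  "conj_list [] = \<^bold>\<top>"
| "conj_list [\<phi>] = \<phi>"
| "conj_list (\<phi> # \<chi> # \<phi>s) = \<phi> \<^bold>\<and> conj_list (\<chi> # \<phi>s)"

definition derives :: "frame_condition set \<Rightarrow> 'p form set \<Rightarrow> 'p form \<Rightarrow> bool" where
  "derives \<Lambda> \<Phi> \<psi> \<longleftrightarrow> (\<exists>\<phi>s. set \<phi>s \<subseteq> \<Phi> \<and> derivable \<Lambda> (conj_list \<phi>s \<^bold>\<rightarrow> \<psi>))"

end

theory Submission
  imports Defs
begin

text \<open>Completeness is by a canonical model whose worlds are the maximal consistent sets of formulas.
  A state \<open>s\<close> of such worlds supports formulas propositionally, with every \<open>\<phi> \<Rrightarrow> \<psi>\<close> read as an atom,
  and \<open>s\<close> is a neighbourhood of \<open>\<Gamma>\<close> as soon as it respects, in this sense, every conditional in \<open>\<Gamma>\<close>.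
  Because this neighbourhood map is as large as possible, each axiom schema forces its frame condition.
  If \<open>\<phi> \<Rrightarrow> \<psi>\<close> is not in \<open>\<Gamma>\<close>, then \<open>{(\<chi>, \<xi>). (\<chi> \<Rrightarrow> \<xi>) \<in> \<Gamma>}\<close> is a preorder with distributive meets
  and joins, so the prime filter theorem gives a prime filter \<open>T\<close> containing \<open>\<phi>\<close> but not \<open>\<psi>\<close>; the set of
  worlds extending \<open>T\<close> is the neighbourhood wanted. It supports exactly the members of \<open>T\<close>, since every
  formula is equivalent to an inquisitive disjunction of declaratives.\<close>

section \<open>Provability from a set of hypotheses\<close>

text \<open>Modus ponens is the only rule that acts on hypotheses; conditional necessitation enters
  through \<open>ax\<close> alone, hence is applied only to theorems. This keeps the deduction
  theorem available.\<close>

inductive prov :: "frame_condition set \<Rightarrow> 'p form set \<Rightarrow> 'p form \<Rightarrow> bool" for \<Lambda> X where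
  hyp: "\<phi> \<in> X \<Longrightarrow> prov \<Lambda> X \<phi>"
| ax: "derivable \<Lambda> \<phi> \<Longrightarrow> prov \<Lambda> X \<phi>"
| mp: "prov \<Lambda> X (\<phi> \<^bold>\<rightarrow> \<psi>) \<Longrightarrow> prov \<Lambda> X \<phi> \<Longrightarrow> prov \<Lambda> X \<psi>"

lemma prov_cut:
  assumes "prov \<Lambda> X \<phi>" and "\<And>\<chi>. \<chi> \<in> X \<Longrightarrow> prov \<Lambda> Y \<chi>"
  shows "prov \<Lambda> Y \<phi>"
  using assms(1) by induction (rule assms(2) prov.ax prov.mp; assumption)+

lemma prov_mono: "prov \<Lambda> X \<phi> \<Longrightarrow> X \<subseteq> Y \<Longrightarrow> prov \<Lambda> Y \<phi>"
  by (erule prov_cut) (auto intro: hyp)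

lemma prov_weaken: "prov \<Lambda> X \<phi> \<Longrightarrow> prov \<Lambda> (insert \<psi> X) \<phi>"
  by (erule prov_mono) auto

lemma prov_K: "prov \<Lambda> X \<psi> \<Longrightarrow> prov \<Lambda> X (\<phi> \<^bold>\<rightarrow> \<psi>)"
  using mp[OF ax[OF K]] .

text \<open>The deduction theorem: \<open>K\<close> settles hypotheses and axioms, \<open>S\<close>
  settles modus ponens, and no modal rule has to be commuted with the discharged hypothesis.\<close>

lemma prov_impI:
  assumes "prov \<Lambda> (insert \<phi> X) \<psi>"
  shows "prov \<Lambda> X (\<phi> \<^bold>\<rightarrow> \<psi>)"
  using assms
proof induction
  case (hyp \<chi>)
  have "prov \<Lambda> X (\<phi> \<^bold>\<rightarrow> \<phi>)"
    by (rule mp[OF mp[OF ax[OF S] ax[OF K]] ax[OF K[of _ _ "\<phi>"]]])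
  with hyp show ?case by (auto intro: prov_K prov.hyp)
next
  case (ax \<chi>)
  then show ?case by (intro prov_K prov.ax)
next
  case (mp \<chi> \<psi>)
  then show ?case using prov.mp[OF prov.mp[OF prov.ax[OF S]]] by blast
qed

lemma prov_hyps [simp]:
  "prov \<Lambda> (insert \<phi> X) \<phi>"
  "prov \<Lambda> (insert \<chi> (insert \<phi> X)) \<phi>"
  "prov \<Lambda> (insert \<chi> (insert \<xi> (insert \<phi> X))) \<phi>"
  by (auto intro: hyp)

lemma prov_imp_iff: "prov \<Lambda> X (\<phi> \<^bold>\<rightarrow> \<psi>) \<longleftrightarrow> prov \<Lambda> (insert \<phi> X) \<psi>"
  by (blast intro: prov_impI dest: mp[OF prov_weaken prov_hyps(1)])

lemma derivable_iff_prov: "derivable \<Lambda> \<phi> \<longleftrightarrow> prov \<Lambda> {} \<phi>"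
proof
  show "derivable \<Lambda> \<phi>" if "prov \<Lambda> {} \<phi>"
    using that by induction (simp_all, rule MP)
qed (rule ax)

lemma derivable_imp_iff: "derivable \<Lambda> (\<phi> \<^bold>\<rightarrow> \<psi>) \<longleftrightarrow> prov \<Lambda> {\<phi>} \<psi>"
  by (simp add: derivable_iff_prov prov_imp_iff)

lemma prov_conj_iff: "prov \<Lambda> X (\<phi> \<^bold>\<and> \<psi>) \<longleftrightarrow> prov \<Lambda> X \<phi> \<and> prov \<Lambda> X \<psi>"
  using mp[OF ax[OF ConjE1]] mp[OF ax[OF ConjE2]] mp[OF mp[OF ax[OF ConjI]]] by metis

lemma prov_disjI1: "prov \<Lambda> X \<phi> \<Longrightarrow> prov \<Lambda> X (\<phi> \<^bold>\<squnion> \<psi>)"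
  and prov_disjI2: "prov \<Lambda> X \<psi> \<Longrightarrow> prov \<Lambda> X (\<phi> \<^bold>\<squnion> \<psi>)"
  using mp[OF ax[OF InqDisjI1]] mp[OF ax[OF InqDisjI2]] by blast+

lemma prov_disjE:
  assumes "prov \<Lambda> X (\<phi> \<^bold>\<squnion> \<psi>)" "prov \<Lambda> (insert \<phi> X) \<chi>" "prov \<Lambda> (insert \<psi> X) \<chi>"
  shows "prov \<Lambda> X \<chi>"
  by (rule mp[OF mp[OF mp[OF ax[OF InqDisjE]]]]) (use assms prov_impI in auto)

text \<open>An invertible left rule, stated as an equivalence so that the simplifier can take
  hypotheses apart, as \<open>prov_hyp_conj\<close> does for conjunctions.\<close>

lemma prov_hyp_disj:
  "prov \<Lambda> (insert (\<phi> \<^bold>\<squnion> \<psi>) X) \<chi> \<longleftrightarrow> prov \<Lambda> (insert \<phi> X) \<chi> \<and> prov \<Lambda> (insert \<psi> X) \<chi>"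
  (is "?L \<longleftrightarrow> ?R")
proof
  assume ?L
  have "prov \<Lambda> (insert \<phi> X) (\<phi> \<^bold>\<squnion> \<psi>)" "prov \<Lambda> (insert \<psi> X) (\<phi> \<^bold>\<squnion> \<psi>)"
    by (simp_all add: prov_disjI1 prov_disjI2)
  then show ?R
    by (intro conjI; intro prov_cut[OF \<open>?L\<close>]) (auto simp: hyp)
next
  assume R: ?R
  show ?L
  proof (rule prov_disjE)
    show "prov \<Lambda> (insert (\<phi> \<^bold>\<squnion> \<psi>) X) (\<phi> \<^bold>\<squnion> \<psi>)" by simp
  qed (rule prov_mono[OF conjunct1[OF R]] prov_mono[OF conjunct2[OF R]]; blast)+
qed

lemma prov_hyp_conj:
  "prov \<Lambda> (insert (\<phi> \<^bold>\<and> \<psi>) X) \<chi> \<longleftrightarrow> prov \<Lambda> (insert \<phi> (insert \<psi> X)) \<chi>"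
  (is "?L \<longleftrightarrow> ?R")
proof
  assume ?L
  then show ?R
    by (rule prov_cut) (auto simp: prov_conj_iff intro: hyp)
next
  have "prov \<Lambda> (insert (\<phi> \<^bold>\<and> \<psi>) X) \<phi>" "prov \<Lambda> (insert (\<phi> \<^bold>\<and> \<psi>) X) \<psi>"
    using prov_hyps(1)[of \<Lambda> "\<phi> \<^bold>\<and> \<psi>" X] by (auto simp: prov_conj_iff)
  moreover assume ?R
  ultimately show ?L
    by (intro prov_cut[OF \<open>?R\<close>]) (auto intro: hyp)
qed

lemma prov_falsum: "prov \<Lambda> X \<^bold>\<bottom> \<Longrightarrow> prov \<Lambda> X \<phi>"
  using mp[OF ax[OF ExFalso]] .

lemma prov_verum [simp]: "prov \<Lambda> X \<^bold>\<top>"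
  by (simp add: Verum_def Neg_def prov_imp_iff)

lemma prov_hyp_verum: "prov \<Lambda> (insert \<^bold>\<top> X) \<phi> \<longleftrightarrow> prov \<Lambda> X \<phi>"
  using mp[OF prov_impI prov_verum] prov_weaken by blast

lemma prov_neg_iff: "prov \<Lambda> X (\<^bold>\<not> \<phi>) \<longleftrightarrow> prov \<Lambda> (insert \<phi> X) \<^bold>\<bottom>"
  by (simp add: Neg_def prov_imp_iff)

lemma prov_modus_ponens_hyp: "prov \<Lambda> (insert \<phi> (insert (\<phi> \<^bold>\<rightarrow> \<psi>) X)) \<psi>"
  using mp[OF prov_hyps(2,1)] .

lemma prov_neg_hyp: "prov \<Lambda> (insert \<phi> (insert (\<^bold>\<not> \<phi>) X)) \<psi>"
  unfolding Neg_def using prov_falsum[OF prov_modus_ponens_hyp] .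

text \<open>Reductio comes from \<open>DDN\<close>, so it is confined to declaratives.\<close>

lemma prov_by_contradiction:
  assumes "declarative \<alpha>" "prov \<Lambda> (insert (\<^bold>\<not> \<alpha>) X) \<^bold>\<bottom>"
  shows "prov \<Lambda> X \<alpha>"
  using mp[OF ax[OF DDN[OF assms(1)]]] assms(2) by (simp add: prov_neg_iff)

lemma prov_conj_list: "prov \<Lambda> X (conj_list \<phi>s) \<longleftrightarrow> (\<forall>\<phi> \<in> set \<phi>s. prov \<Lambda> X \<phi>)"
  by (induction \<phi>s rule: conj_list.induct) (auto simp: prov_conj_iff)

text \<open>A derivation uses finitely many hypotheses, and a finite list of them is interderivable
  with its conjunction.\<close>

lemma prov_iff_derives: "prov \<Lambda> X \<phi> \<longleftrightarrow> derives \<Lambda> X \<phi>"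
proof
  assume "prov \<Lambda> X \<phi>"
  then have "\<exists>\<phi>s. set \<phi>s \<subseteq> X \<and> prov \<Lambda> (set \<phi>s) \<phi>"
  proof induction
    case (hyp \<phi>)
    then show ?case by (intro exI[of _ "[\<phi>]"]) simp
  next
    case (ax \<phi>)
    then show ?case by (intro exI[of _ "[]"]) (simp add: prov.ax)
  next
    case (mp \<phi> \<psi>)
    then obtain \<phi>s \<psi>s where "set \<phi>s \<subseteq> X" "prov \<Lambda> (set \<phi>s) (\<phi> \<^bold>\<rightarrow> \<psi>)"
      "set \<psi>s \<subseteq> X" "prov \<Lambda> (set \<psi>s) \<phi>" by blast
    then show ?case
      using prov.mp[OF prov_mono prov_mono, of \<Lambda> "set \<phi>s" \<phi> \<psi> "set (\<phi>s @ \<psi>s)" "set \<psi>s"]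
      by (intro exI[of _ "\<phi>s @ \<psi>s"]) simp
  qed
  then obtain \<phi>s where "set \<phi>s \<subseteq> X" "prov \<Lambda> (set \<phi>s) \<phi>" by blast
  moreover have "\<forall>\<chi> \<in> set \<phi>s. prov \<Lambda> {conj_list \<phi>s} \<chi>"
    using prov_hyps(1)[of \<Lambda> "conj_list \<phi>s" "{}"] unfolding prov_conj_list .
  ultimately show "derives \<Lambda> X \<phi>"
    unfolding derives_def derivable_imp_iff using prov_cut[of \<Lambda> "set \<phi>s"] by blast
next
  assume "derives \<Lambda> X \<phi>"
  then obtain \<phi>s where "set \<phi>s \<subseteq> X" "derivable \<Lambda> (conj_list \<phi>s \<^bold>\<rightarrow> \<phi>)"
    unfolding derives_def by blast
  then show "prov \<Lambda> X \<phi>"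
    using mp[OF ax] by (metis hyp prov_conj_list subsetD)
qed

section \<open>Resolutions\<close>

definition equivalent :: "frame_condition set \<Rightarrow> 'p form \<Rightarrow> 'p form \<Rightarrow> bool" where
  "equivalent \<Lambda> \<phi> \<psi> \<longleftrightarrow> prov \<Lambda> {\<phi>} \<psi> \<and> prov \<Lambda> {\<psi>} \<phi>"

text \<open>The normal form turned into an induction principle: once every formula is shown
  resolvable, a property stable under provable equivalence can be checked on declaratives and
  inquisitive disjunctions alone.\<close>

inductive resolvable :: "frame_condition set \<Rightarrow> 'p form \<Rightarrow> bool" for \<Lambda> where
  declarative: "declarative \<alpha> \<Longrightarrow> resolvable \<Lambda> \<alpha>"
| disj: "resolvable \<Lambda> \<phi> \<Longrightarrow> resolvable \<Lambda> \<psi> \<Longrightarrow> resolvable \<Lambda> (\<phi> \<^bold>\<squnion> \<psi>)"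
| equiv: "resolvable \<Lambda> \<phi> \<Longrightarrow> equivalent \<Lambda> \<phi> \<psi> \<Longrightarrow> resolvable \<Lambda> \<psi>"

lemma equivalent_conj:
  "equivalent \<Lambda> \<phi> \<phi>' \<Longrightarrow> equivalent \<Lambda> \<psi> \<psi>' \<Longrightarrow> equivalent \<Lambda> (\<phi> \<^bold>\<and> \<psi>) (\<phi>' \<^bold>\<and> \<psi>')"
  unfolding equivalent_def prov_conj_iff prov_hyp_conj
  by (intro conjI; elim conjE prov_mono) auto

lemma equivalent_imp:
  assumes "equivalent \<Lambda> \<phi> \<phi>'" "equivalent \<Lambda> \<psi> \<psi>'"
  shows "equivalent \<Lambda> (\<phi> \<^bold>\<rightarrow> \<psi>) (\<phi>' \<^bold>\<rightarrow> \<psi>')"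
proof -
  have "prov \<Lambda> {\<phi>', \<phi> \<^bold>\<rightarrow> \<psi>} \<psi>'"
    if "prov \<Lambda> {\<phi>'} \<phi>" "prov \<Lambda> {\<psi>} \<psi>'" for \<phi> \<phi>' \<psi> \<psi>' :: "'a form"
  proof -
    have "prov \<Lambda> {\<phi>', \<phi> \<^bold>\<rightarrow> \<psi>} \<psi>"
      by (rule mp[OF prov_hyps(2) prov_mono[OF that(1)]]) simp
    then show ?thesis by (intro prov_cut[OF that(2)]) simp
  qed
  then show ?thesis using assms by (simp add: equivalent_def prov_imp_iff)
qed

lemma equivalent_refl [simp]: "equivalent \<Lambda> \<phi> \<phi>"
  by (simp add: equivalent_def)

text \<open>Conjunction distributes over inquisitive disjunction on either side. The outer induction
  reduces the left conjunct to a declarative, the inner one then takes the right conjunct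
  apart.\<close>

lemma resolvable_conj:
  assumes "resolvable \<Lambda> \<phi>" "resolvable \<Lambda> \<psi>"
  shows "resolvable \<Lambda> (\<phi> \<^bold>\<and> \<psi>)"
  using assms
proof (induction arbitrary: \<psi>)
  case (declarative \<alpha>)
  from declarative(2) show ?case
  proof induction
    case (disj \<phi> \<psi>)
    have "equivalent \<Lambda> ((\<alpha> \<^bold>\<and> \<phi>) \<^bold>\<squnion> (\<alpha> \<^bold>\<and> \<psi>)) (\<alpha> \<^bold>\<and> (\<phi> \<^bold>\<squnion> \<psi>))"
      by (simp add: equivalent_def prov_hyp_conj prov_hyp_disj prov_conj_iff prov_disjI1 prov_disjI2
          insert_commute[of \<alpha>])
    then show ?case by (rule resolvable.equiv[OF resolvable.disj[OF disj.IH]])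
  next
    case (equiv \<phi> \<psi>)
    show ?case by (rule resolvable.equiv[OF equiv.IH equivalent_conj[OF equivalent_refl equiv.hyps(2)]])
  qed (use declarative(1) in \<open>auto intro: resolvable.declarative\<close>)
next
  case (disj \<phi> \<chi>)
  have "equivalent \<Lambda> ((\<phi> \<^bold>\<and> \<psi>) \<^bold>\<squnion> (\<chi> \<^bold>\<and> \<psi>)) ((\<phi> \<^bold>\<squnion> \<chi>) \<^bold>\<and> \<psi>)"
    by (simp add: equivalent_def prov_hyp_conj prov_hyp_disj prov_conj_iff prov_disjI1 prov_disjI2)
  then show ?case by (rule resolvable.equiv[OF resolvable.disj[OF disj.IH(1,2)[OF disj.prems]]])
next
  case (equiv \<phi> \<chi>)
  show ?case
    by (rule resolvable.equiv[OF equiv.IH[OF equiv.prems] equivalent_conj[OF equiv.hyps(2) equivalent_refl]])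
qed

text \<open>A disjunctive antecedent turns the implication into a conjunction, which
  \<open>resolvable_conj\<close> handles; under a declarative antecedent \<open>Split\<close> moves
  the implication inside the disjunction.\<close>

lemma resolvable_imp:
  assumes "resolvable \<Lambda> \<phi>" "resolvable \<Lambda> \<psi>"
  shows "resolvable \<Lambda> (\<phi> \<^bold>\<rightarrow> \<psi>)"
  using assms
proof (induction arbitrary: \<psi>)
  case (declarative \<alpha>)
  from declarative(2) show ?case
  proof induction
    case (disj \<phi> \<psi>)
    have "prov \<Lambda> {\<alpha> \<^bold>\<rightarrow> \<phi> \<^bold>\<squnion> \<psi>} ((\<alpha> \<^bold>\<rightarrow> \<phi>) \<^bold>\<squnion> (\<alpha> \<^bold>\<rightarrow> \<psi>))"
      using Split[OF declarative(1)] by (simp add: derivable_imp_iff)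
    then have "equivalent \<Lambda> ((\<alpha> \<^bold>\<rightarrow> \<phi>) \<^bold>\<squnion> (\<alpha> \<^bold>\<rightarrow> \<psi>)) (\<alpha> \<^bold>\<rightarrow> \<phi> \<^bold>\<squnion> \<psi>)"
      by (simp add: equivalent_def prov_hyp_disj prov_imp_iff prov_disjI1 prov_disjI2
          prov_modus_ponens_hyp insert_commute[of \<alpha> "(\<alpha> \<^bold>\<rightarrow> \<phi>) \<^bold>\<squnion> (\<alpha> \<^bold>\<rightarrow> \<psi>)"]
          insert_commute[of "\<alpha> \<^bold>\<rightarrow> _" \<alpha>])
    then show ?case by (rule resolvable.equiv[OF resolvable.disj[OF disj.IH]])
  next
    case (equiv \<phi> \<psi>)
    show ?case by (rule resolvable.equiv[OF equiv.IH equivalent_imp[OF equivalent_refl equiv.hyps(2)]])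
  qed (use declarative(1) in \<open>auto intro: resolvable.declarative\<close>)
next
  case (disj \<phi> \<chi>)
  have "prov \<Lambda> {\<phi>, \<phi> \<^bold>\<squnion> \<chi> \<^bold>\<rightarrow> \<psi>} \<psi>" "prov \<Lambda> {\<chi>, \<phi> \<^bold>\<squnion> \<chi> \<^bold>\<rightarrow> \<psi>} \<psi>"
    using mp[OF prov_hyps(2) prov_disjI1[OF prov_hyps(1)]] mp[OF prov_hyps(2) prov_disjI2[OF prov_hyps(1)]]
    by blast+
  moreover have "prov \<Lambda> {\<phi>, \<phi> \<^bold>\<rightarrow> \<psi>, \<chi> \<^bold>\<rightarrow> \<psi>} \<psi>" "prov \<Lambda> {\<chi>, \<phi> \<^bold>\<rightarrow> \<psi>, \<chi> \<^bold>\<rightarrow> \<psi>} \<psi>"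
    using mp[OF prov_hyps(2,1)] mp[OF prov_hyps(3,1)] by blast+
  ultimately have "equivalent \<Lambda> ((\<phi> \<^bold>\<rightarrow> \<psi>) \<^bold>\<and> (\<chi> \<^bold>\<rightarrow> \<psi>)) ((\<phi> \<^bold>\<squnion> \<chi>) \<^bold>\<rightarrow> \<psi>)"
    by (simp add: equivalent_def prov_hyp_conj prov_hyp_disj prov_conj_iff prov_imp_iff
        insert_commute[of _ "(\<phi> \<^bold>\<rightarrow> \<psi>) \<^bold>\<and> (\<chi> \<^bold>\<rightarrow> \<psi>)"] insert_commute[of "_ \<^bold>\<rightarrow> _" "\<phi> \<^bold>\<squnion> \<chi>"])
  then show ?case by (rule resolvable.equiv[OF resolvable_conj[OF disj.IH(1,2)[OF disj.prems]]])
next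
  case (equiv \<phi> \<chi>)
  show ?case
    by (rule resolvable.equiv[OF equiv.IH[OF equiv.prems] equivalent_imp[OF equiv.hyps(2) equivalent_refl]])
qed

lemma resolvable: "resolvable \<Lambda> \<phi>"
  by (induction \<phi>) (auto intro: resolvable.declarative disj resolvable_conj resolvable_imp)

lemmas resolution_induct = resolvable.induct[OF resolvable, consumes 0, case_names declarative disj equiv]

section \<open>Support with modal formulas read as atoms\<close>

text \<open>The valuation fixes atoms and whole conditionals world by world, which separates the
  propositional part of support from the neighbourhoods. One set of facts then serves both in-models
  and sets of canonical worlds.\<close>

primrec psupports :: "('w \<Rightarrow> 'p form \<Rightarrow> bool) \<Rightarrow> 'w set \<Rightarrow> 'p form \<Rightarrow> bool" where
  "psupports v s (Atom p) \<longleftrightarrow> (\<forall>w \<in> s. v w (Atom p))"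
| "psupports v s \<^bold>\<bottom> \<longleftrightarrow> s = {}"
| "psupports v s (\<phi> \<^bold>\<and> \<psi>) \<longleftrightarrow> psupports v s \<phi> \<and> psupports v s \<psi>"
| "psupports v s (\<phi> \<^bold>\<rightarrow> \<psi>) \<longleftrightarrow> (\<forall>t. t \<subseteq> s \<longrightarrow> psupports v t \<phi> \<longrightarrow> psupports v t \<psi>)"
| "psupports v s (\<phi> \<^bold>\<squnion> \<psi>) \<longleftrightarrow> psupports v s \<phi> \<or> psupports v s \<psi>"
| "psupports v s (\<phi> \<Rrightarrow> \<psi>) \<longleftrightarrow> (\<forall>w \<in> s. v w (\<phi> \<Rrightarrow> \<psi>))"

text \<open>Atoms and conditionals are supported by a state just when each of its singletons
  supports them, so every in-model is an instance of the abstract semantics.\<close>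

lemma supports_iff_psupports:
  "supports M s \<phi> \<longleftrightarrow> psupports (\<lambda>w. supports M {w}) s \<phi>"
  by (induction \<phi> arbitrary: s) simp_all

lemma psupports_persistent: "psupports v s \<phi> \<Longrightarrow> t \<subseteq> s \<Longrightarrow> psupports v t \<phi>"
  by (induction \<phi> arbitrary: s t) (auto 0 4)

lemma psupports_empty [simp]: "psupports v {} \<phi>"
  by (induction \<phi>) auto

text \<open>Implication is the case that matters: persistence takes support of the antecedent down
  to singletons, and the induction hypothesis collects the consequent back from them.\<close>

lemma psupports_truth_conditional:
  "declarative \<alpha> \<Longrightarrow> psupports v s \<alpha> \<longleftrightarrow> (\<forall>w \<in> s. psupports v {w} \<alpha>)"
proof (induction \<alpha> arbitrary: s)
  case (Impl \<alpha> \<beta>)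
  show ?case
  proof
    assume *: "\<forall>w \<in> s. psupports v {w} (\<alpha> \<^bold>\<rightarrow> \<beta>)"
    show "psupports v s (\<alpha> \<^bold>\<rightarrow> \<beta>)"
      unfolding psupports.simps
    proof (intro allI impI)
      fix t assume t: "t \<subseteq> s" "psupports v t \<alpha>"
      have "psupports v {w} \<beta>" if "w \<in> t" for w
      proof -
        have "psupports v {w} \<alpha>" by (rule psupports_persistent[OF t(2)]) (simp add: that)
        with * t(1) that show ?thesis by auto
      qed
      moreover have "declarative \<beta>" using Impl.prems by simp
      ultimately show "psupports v t \<beta>" using Impl.IH(2) by blast
    qed
  next
    assume "psupports v s (\<alpha> \<^bold>\<rightarrow> \<beta>)"
    then show "\<forall>w \<in> s. psupports v {w} (\<alpha> \<^bold>\<rightarrow> \<beta>)"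
      by (auto simp del: psupports.simps elim: psupports_persistent)
  qed
next
  case (Conj \<alpha> \<beta>)
  from Conj.prems Conj.IH[of s] show ?case by auto
qed simp_all

lemma psupports_singleton_imp [simp]:
  "psupports v {w} (\<phi> \<^bold>\<rightarrow> \<psi>) \<longleftrightarrow> (psupports v {w} \<phi> \<longrightarrow> psupports v {w} \<psi>)"
  by (auto simp: subset_singleton_iff)

text \<open>A nonempty state that supports \<phi> has, by persistence, a singleton that supports
  it.\<close>

lemma psupports_neg [simp]:
  "psupports v s (\<^bold>\<not> \<phi>) \<longleftrightarrow> (\<forall>w \<in> s. \<not> psupports v {w} \<phi>)"
proof
  assume *: "\<forall>w \<in> s. \<not> psupports v {w} \<phi>"
  have "t = {}" if "t \<subseteq> s" "psupports v t \<phi>" for t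
  proof (rule ccontr)
    assume "t \<noteq> {}"
    then obtain w where "{w} \<subseteq> t" by blast
    with psupports_persistent[OF that(2) this] * that(1) show False by blast
  qed
  then show "psupports v s (\<^bold>\<not> \<phi>)" by (simp add: Neg_def)
qed (auto simp: Neg_def)

text \<open>With this, the soundness of a frame schema has to be checked only at single worlds. For
  union closure it matters that the conclusion uses classical disjunction.\<close>

lemma declarative_schema: "\<phi> \<in> schema c \<Longrightarrow> declarative \<phi>"
  by (cases c) (auto simp: Box_def Neg_def Disj_def)

text \<open>Soundness relative to an abstract valuation, with the modal axioms and the modal rule
  left as conditions on it. The condition \<open>CondNec\<close> offers both the derivability of the
  implication and its support throughout \<open>W\<close>: in-models use the second, canonical
  worlds the first.\<close>

lemma psupports_derivable:
  assumes "derivable \<Lambda> \<phi>" "s \<subseteq> W"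
    and Trans: "\<And>w \<phi> \<psi> \<chi>. w \<in> W \<Longrightarrow> v w (\<phi> \<Rrightarrow> \<psi>) \<Longrightarrow> v w (\<psi> \<Rrightarrow> \<chi>) \<Longrightarrow> v w (\<phi> \<Rrightarrow> \<chi>)"
    and RConj: "\<And>w \<phi> \<psi> \<chi>. w \<in> W \<Longrightarrow> v w (\<phi> \<Rrightarrow> \<psi>) \<Longrightarrow> v w (\<phi> \<Rrightarrow> \<chi>) \<Longrightarrow> v w (\<phi> \<Rrightarrow> \<psi> \<^bold>\<and> \<chi>)"
    and LDisj: "\<And>w \<phi> \<psi> \<chi>. w \<in> W \<Longrightarrow> v w (\<phi> \<Rrightarrow> \<chi>) \<Longrightarrow> v w (\<psi> \<Rrightarrow> \<chi>) \<Longrightarrow> v w (\<phi> \<^bold>\<squnion> \<psi> \<Rrightarrow> \<chi>)"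
    and Schema: "\<And>w c \<phi>. w \<in> W \<Longrightarrow> c \<in> \<Lambda> \<Longrightarrow> \<phi> \<in> schema c \<Longrightarrow> psupports v {w} \<phi>"
    and CondNec: "\<And>w \<phi> \<psi>. w \<in> W \<Longrightarrow> derivable \<Lambda> (\<phi> \<^bold>\<rightarrow> \<psi>) \<Longrightarrow>
      (\<And>s. s \<subseteq> W \<Longrightarrow> psupports v s (\<phi> \<^bold>\<rightarrow> \<psi>)) \<Longrightarrow> v w (\<phi> \<Rrightarrow> \<psi>)"
  shows "psupports v s \<phi>"
  using assms(1,2)
proof (induction arbitrary: s)
  case (K \<phi> \<psi>)
  then show ?case by (auto intro: psupports_persistent)
next
  case (S \<phi> \<psi> \<chi>)
  then show ?case by (simp, meson order_refl order_trans)
next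
  case (ConjI \<phi> \<psi>)
  then show ?case by (auto intro: psupports_persistent)
next
  case (InqDisjE \<phi> \<chi> \<psi>)
  show ?case by auto
next
  case (DDN \<alpha>)
  \<comment> \<open>The axiom is itself declarative, so it is enough to look at singletons, where
    negation is classical.\<close>
  then have "declarative (\<^bold>\<not> \<^bold>\<not> \<alpha> \<^bold>\<rightarrow> \<alpha>)" by (simp add: Neg_def)
  from psupports_truth_conditional[OF this] show ?case
    by (simp del: psupports.simps(4))
next
  case (Split \<alpha> \<phi> \<psi>)
  \<comment> \<open>The \<alpha>-worlds of \<open>t\<close> form its largest substate supporting the
    declarative \<alpha>, so by persistence the implication is tested there alone, and
    \<open>Split\<close> reduces to the support clause of inquisitive disjunction at one
    state.\<close>
  have imp_iff: "psupports v t (\<alpha> \<^bold>\<rightarrow> \<chi>) \<longleftrightarrow> psupports v {w \<in> t. psupports v {w} \<alpha>} \<chi>" for t \<chi>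
    unfolding psupports.simps
  proof
    assume "psupports v {w \<in> t. psupports v {w} \<alpha>} \<chi>"
    moreover have "u \<subseteq> {w \<in> t. psupports v {w} \<alpha>}" if "u \<subseteq> t" "psupports v u \<alpha>" for u
      using that psupports_truth_conditional[OF Split(1), of v u] by auto
    ultimately show "\<forall>u. u \<subseteq> t \<longrightarrow> psupports v u \<alpha> \<longrightarrow> psupports v u \<chi>"
      by (blast intro: psupports_persistent)
  next
    assume *: "\<forall>u. u \<subseteq> t \<longrightarrow> psupports v u \<alpha> \<longrightarrow> psupports v u \<chi>"
    have "psupports v {w \<in> t. psupports v {w} \<alpha>} \<alpha>"
      by (rule iffD2[OF psupports_truth_conditional[OF Split(1)]]) simp
    then show "psupports v {w \<in> t. psupports v {w} \<alpha>} \<chi>"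
      using * by (metis (no_types, lifting) mem_Collect_eq subsetI)
  qed
  show ?case
    unfolding psupports.simps(4)[of v s] by (simp add: imp_iff del: psupports.simps(4))
next
  case (Trans \<phi> \<psi> \<chi>)
  then show ?case using assms(3) by (simp, blast)
next
  case (RConj \<phi> \<psi> \<chi>)
  then show ?case using assms(4) by (simp, blast)
next
  case (LDisj \<phi> \<chi> \<psi>)
  then show ?case using assms(5) by (simp, blast)
next
  case (Schema c \<phi>)
  then show ?case
    using psupports_truth_conditional[OF declarative_schema[OF Schema(2)]] assms(6) by blast
next
  case (CondNec \<phi> \<psi>)
  then show ?case using assms(7) by (simp del: psupports.simps(4)) blast
qed auto

section \<open>Soundness\<close>

lemmas supports_truth_conditional =
  psupports_truth_conditional[of _ "\<lambda>w. supports M {w}" for M, folded supports_iff_psupports]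

lemmas supports_neg = psupports_neg[of "\<lambda>w. supports M {w}" for M, folded supports_iff_psupports]

lemmas supports_persistent =
  psupports_persistent[of "\<lambda>w. supports M {w}" for M, folded supports_iff_psupports]

lemmas supports_singleton_imp =
  psupports_singleton_imp[of "\<lambda>w. supports M {w}" for M, folded supports_iff_psupports]

lemma supports_verum: "supports M s \<^bold>\<top>"
  by (simp add: Verum_def supports_neg)

lemma supports_box: "supports M s (\<^bold>\<box> \<phi>) \<longleftrightarrow> (\<forall>w \<in> s. \<forall>t \<in> nbhds M w. supports M t \<phi>)"
  by (simp add: Box_def supports_verum)

lemma supports_schema:
  assumes "in_frame M" "satisfies M c" "w \<in> worlds M" "\<phi> \<in> schema c"
  shows "supports M {w} \<phi>"
proof -
  \<comment> \<open>\<open>in_frame\<close> places the members of neighbourhoods among the worlds,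
    over which the last two frame conditions quantify.\<close>
  have accessible: "v \<in> worlds M \<and> accessible M w v" if "s \<in> nbhds M w" "v \<in> s" for s v
    using that assms(1,3) unfolding in_frame_def accessible_def by blast
  show ?thesis
  proof (cases c)
    case Downward_Monotonicity
    then obtain \<chi> \<psi> where \<phi>: "\<phi> = (\<chi> \<Rrightarrow> \<psi>) \<^bold>\<rightarrow> \<^bold>\<box> (\<chi> \<^bold>\<rightarrow> \<psi>)" using assms by auto
    have "t \<in> nbhds M w" if "s \<in> nbhds M w" "t \<subseteq> s" "t \<noteq> {}" for s t
      using assms that Downward_Monotonicity by auto
    \<comment> \<open>Downward monotonicity is silent about the empty substate, but that state
      supports every formula.\<close>
    moreover have "supports M {} \<psi>"
      by (simp add: supports_iff_psupports)
    ultimately show ?thesis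
      by (simp add: \<phi> supports_singleton_imp supports_box del: supports.simps(4))
        (metis supports.simps(4))
  next
    case Finite_Union_Closure
    then obtain \<alpha> \<chi> \<psi> where \<phi>: "\<phi> = (\<alpha> \<Rrightarrow> \<chi> \<^bold>\<squnion> \<psi>) \<^bold>\<rightarrow> (\<alpha> \<Rrightarrow> \<chi>) \<^bold>\<or> (\<alpha> \<Rrightarrow> \<psi>)"
      and \<alpha>: "declarative \<alpha>"
      using assms by auto
    \<comment> \<open>If some \<alpha>-neighbourhood \<open>s\<close> fails \<chi>, then every
      \<alpha>-neighbourhood \<open>t\<close> supports \<psi>: the union still supports the
      declarative \<alpha>, fails \<chi> by persistence, and hence supports \<psi>, which persists
      to \<open>t\<close>.\<close>
    have "supports M t \<psi>"
      if *: "\<forall>s \<in> nbhds M w. supports M s \<alpha> \<longrightarrow> supports M s \<chi> \<or> supports M s \<psi>"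
        and s: "s \<in> nbhds M w" "supports M s \<alpha>" "\<not> supports M s \<chi>"
        and t: "t \<in> nbhds M w" "supports M t \<alpha>" for s t
    proof -
      have "s \<union> t \<in> nbhds M w" using s t assms Finite_Union_Closure by simp
      moreover have "supports M (s \<union> t) \<alpha>"
        using s(2) t(2) supports_truth_conditional[OF \<alpha>] by (metis Un_iff)
      moreover have "\<not> supports M (s \<union> t) \<chi>"
        using s(3) supports_persistent by (metis Un_upper1)
      ultimately have "supports M (s \<union> t) \<psi>" using * by blast
      then show ?thesis by (rule supports_persistent) simp
    qed
    then show ?thesis
      by (simp add: \<phi> supports_singleton_imp Disj_def supports_neg del: supports.simps(4)) blast
  next
    case Reflexivity
    then obtain \<alpha> where \<phi>: "\<phi> = \<^bold>\<box> \<alpha> \<^bold>\<rightarrow> \<alpha>" using assms by auto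
    obtain s where "s \<in> nbhds M w" "w \<in> s" using assms Reflexivity by auto
    then show ?thesis
      by (auto simp: \<phi> supports_singleton_imp supports_box simp del: supports.simps(4)
          elim: supports_persistent)
  next
    case Non_Triviality
    then obtain s where "s \<in> nbhds M w" using assms by auto
    with assms Non_Triviality show ?thesis
      by (auto simp: supports_neg supports_box in_frame_def)
  next
    case Decreasingness
    then obtain \<chi> \<psi> where \<phi>: "\<phi> = (\<chi> \<Rrightarrow> \<psi>) \<^bold>\<rightarrow> \<^bold>\<box> (\<chi> \<Rrightarrow> \<psi>)" using assms by auto
    have "nbhds M v \<subseteq> nbhds M w" if "s \<in> nbhds M w" "v \<in> s" for s v
      using accessible[OF that] assms(2,3) Decreasingness by simp
    then show ?thesis
      by (simp add: \<phi> supports_singleton_imp supports_box del: supports.simps(4)) blast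
  next
    case Increasingness
    then obtain \<chi> \<psi> where \<phi>: "\<phi> = \<^bold>\<not> (\<chi> \<Rrightarrow> \<psi>) \<^bold>\<rightarrow> \<^bold>\<box> (\<^bold>\<not> (\<chi> \<Rrightarrow> \<psi>))"
      using assms by auto
    have "nbhds M w \<subseteq> nbhds M v" if "s \<in> nbhds M w" "v \<in> s" for s v
      using accessible[OF that] assms(2,3) Increasingness by simp
    then show ?thesis
      by (simp add: \<phi> supports_singleton_imp supports_box supports_neg del: supports.simps(4)) blast
  qed
qed

lemma supports_derivable:
  assumes "derivable \<Lambda> \<phi>" "in_frame M" "\<forall>c \<in> \<Lambda>. satisfies M c" "s \<subseteq> worlds M"
  shows "supports M s \<phi>"
proof (rule iffD2[OF supports_iff_psupports], rule psupports_derivable[OF assms(1,4)])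
  \<comment> \<open>Neighbourhoods are themselves states inside \<open>worlds M\<close>, so an
    implication supported by all states is supported there.\<close>
  show "supports M {w} (\<phi> \<Rrightarrow> \<psi>)"
    if "w \<in> worlds M" "\<And>s. s \<subseteq> worlds M \<Longrightarrow> psupports (\<lambda>w. supports M {w}) s (\<phi> \<^bold>\<rightarrow> \<psi>)" for w \<phi> \<psi>
    using that assms(2) unfolding supports_iff_psupports[symmetric] in_frame_def
    by (simp, meson order_refl)
  show "psupports (\<lambda>w. supports M {w}) {w} \<phi>"
    if "w \<in> worlds M" "c \<in> \<Lambda>" "\<phi> \<in> schema c" for w c \<phi>
    using supports_schema[OF assms(2) _ that(1,3)] assms(3) that(2)
    by (simp flip: supports_iff_psupports)
qed simp_all

lemma soundness:
  assumes "derives \<Lambda> \<Phi> \<psi>"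
  shows "entails TYPE('w) \<Lambda> \<Phi> \<psi>"
  unfolding entails_def
proof (intro allI impI)
  fix M :: "('w, 'a) in_model" and s
  assume M: "in_frame M" "\<forall>c \<in> \<Lambda>. satisfies M c" "s \<subseteq> worlds M" "\<forall>\<phi> \<in> \<Phi>. supports M s \<phi>"
  have "prov \<Lambda> \<Phi> \<psi>" using assms by (simp add: prov_iff_derives)
  then show "supports M s \<psi>"
  proof induction
    case (mp \<phi> \<psi>)
    then show ?case by auto
  qed (use M supports_derivable in auto)
qed

section \<open>Prime filters\<close>

text \<open>The two instances are provability from a fixed set of hypotheses and the conditionals that hold
  at a world; the latter has no deduction theorem, so only the lattice structure is assumed.\<close>

locale entailment =
  fixes \<Lambda> :: "frame_condition set" and R :: "'p form \<Rightarrow> 'p form \<Rightarrow> bool"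
  assumes prov: "prov \<Lambda> {\<phi>} \<psi> \<Longrightarrow> R \<phi> \<psi>"
    and trans: "R \<phi> \<psi> \<Longrightarrow> R \<psi> \<chi> \<Longrightarrow> R \<phi> \<chi>"
    and conj: "R \<phi> \<psi> \<Longrightarrow> R \<phi> \<chi> \<Longrightarrow> R \<phi> (\<psi> \<^bold>\<and> \<chi>)"
    and disj: "R \<phi> \<chi> \<Longrightarrow> R \<psi> \<chi> \<Longrightarrow> R (\<phi> \<^bold>\<squnion> \<psi>) \<chi>"
begin

definition deductive_filter :: "'p form set \<Rightarrow> bool" where
  "deductive_filter T \<longleftrightarrow> T \<noteq> {} \<and> (\<forall>\<phi> \<in> T. \<forall>\<psi> \<in> T. \<phi> \<^bold>\<and> \<psi> \<in> T) \<and> (\<forall>\<phi> \<in> T. \<forall>\<psi>. R \<phi> \<psi> \<longrightarrow> \<psi> \<in> T)"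

text \<open>Modus ponens is handled inside the filter: it contains the conjunction of both premises,
  and \<open>R\<close> relates that conjunction to the conclusion.\<close>

lemma deductive_filter_closed:
  assumes "deductive_filter T" "prov \<Lambda> T \<phi>"
  shows "\<phi> \<in> T"
  using assms(2)
proof induction
  case (ax \<phi>)
  obtain \<chi> where "\<chi> \<in> T" using assms(1) by (auto simp: deductive_filter_def)
  moreover have "R \<chi> \<phi>" using ax by (intro prov prov.ax)
  ultimately show ?case using assms(1) by (auto simp: deductive_filter_def)
next
  case (mp \<phi> \<psi>)
  have "R (\<phi> \<^bold>\<and> (\<phi> \<^bold>\<rightarrow> \<psi>)) \<psi>"
    by (rule prov) (simp add: prov_hyp_conj prov_modus_ponens_hyp)
  then show ?case using mp.IH assms(1) unfolding deductive_filter_def by blast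
qed

text \<open>Zorn's lemma among the filters that contain \<phi> and miss \<open>D\<close>. The last
  conclusion rephrases maximality: the filter generated by \<open>T\<close> and a formula outside it
  must meet \<open>D\<close>.\<close>

lemma maximal_filter:
  assumes "\<And>\<delta>. \<delta> \<in> D \<Longrightarrow> \<not> R \<phi> \<delta>"
  obtains T where "deductive_filter T" "\<phi> \<in> T" "T \<inter> D = {}"
    "\<And>\<chi>. \<chi> \<notin> T \<Longrightarrow> \<exists>\<tau> \<in> T. \<exists>\<delta> \<in> D. R (\<tau> \<^bold>\<and> \<chi>) \<delta>"
proof -
  define A where "A = {T. deductive_filter T \<and> \<phi> \<in> T \<and> T \<inter> D = {}}"
  have "R \<phi> \<phi>" by (simp add: prov)
  \<comment> \<open>The principal filter of \<phi> shows that the family is nonempty.\<close>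
  then have "{\<chi>. R \<phi> \<chi>} \<in> A"
    unfolding A_def deductive_filter_def using assms by (auto intro: conj trans)
  then have "A \<noteq> {}" by blast
  moreover have "\<Union> C \<in> A" if C: "C \<noteq> {}" "subset.chain A C" for C
  proof -
    have "\<phi>' \<^bold>\<and> \<psi> \<in> \<Union> C" if "\<phi>' \<in> \<Union> C" "\<psi> \<in> \<Union> C" for \<phi>' \<psi>
    proof -
      from that obtain T U where TU: "T \<in> C" "U \<in> C" "\<phi>' \<in> T" "\<psi> \<in> U" by blast
      then have "T \<subseteq> U \<or> U \<subseteq> T" using C(2) by (auto simp: subset_chain_def)
      then obtain V where "V \<in> C" "\<phi>' \<in> V" "\<psi> \<in> V" using TU by blast
      moreover have "deductive_filter V" using C(2) \<open>V \<in> C\<close> by (auto simp: subset_chain_def A_def)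
      ultimately show ?thesis unfolding deductive_filter_def by blast
    qed
    moreover have CA: "deductive_filter T \<and> \<phi> \<in> T \<and> T \<inter> D = {}" if "T \<in> C" for T
      using that C(2) by (auto simp: subset_chain_def A_def)
    moreover have "\<psi> \<in> \<Union> C" if "\<chi> \<in> \<Union> C" "R \<chi> \<psi>" for \<chi> \<psi>
      using that CA unfolding deductive_filter_def by blast
    ultimately show ?thesis
      using C(1) unfolding A_def deductive_filter_def by blast
  qed
  ultimately obtain T where T: "T \<in> A" and max: "\<And>U. U \<in> A \<Longrightarrow> T \<subseteq> U \<Longrightarrow> U = T"
    using subset_Zorn_nonempty[of A] by blast
  have filter: "deductive_filter T" using T by (simp add: A_def)
  have "\<exists>\<tau> \<in> T. \<exists>\<delta> \<in> D. R (\<tau> \<^bold>\<and> \<chi>) \<delta>" if "\<chi> \<notin> T" for \<chi>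
  proof (rule ccontr)
    assume *: "\<not> (\<exists>\<tau> \<in> T. \<exists>\<delta> \<in> D. R (\<tau> \<^bold>\<and> \<chi>) \<delta>)"
    \<comment> \<open>The filter generated by \<open>T\<close> and \<chi>; by assumption it still
      misses \<open>D\<close>, against maximality.\<close>
    define U where "U = {\<xi>. \<exists>\<tau> \<in> T. R (\<tau> \<^bold>\<and> \<chi>) \<xi>}"
    have "R (\<tau> \<^bold>\<and> \<chi>) \<tau>" "R (\<tau> \<^bold>\<and> \<chi>) \<chi>" for \<tau>
      by (simp_all add: prov prov_hyp_conj)
    then have TU: "T \<subseteq> U" "\<chi> \<in> U"
      using T unfolding U_def A_def by blast+
    have "\<xi> \<^bold>\<and> \<xi>' \<in> U" if \<xi>: "\<xi> \<in> U" "\<xi>' \<in> U" for \<xi> \<xi>'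
    proof -
      obtain \<tau> \<tau>' where \<tau>: "\<tau> \<in> T" "R (\<tau> \<^bold>\<and> \<chi>) \<xi>" "\<tau>' \<in> T" "R (\<tau>' \<^bold>\<and> \<chi>) \<xi>'"
        using \<xi> unfolding U_def by blast
      have "R ((\<tau> \<^bold>\<and> \<tau>') \<^bold>\<and> \<chi>) (\<tau> \<^bold>\<and> \<chi>)" "R ((\<tau> \<^bold>\<and> \<tau>') \<^bold>\<and> \<chi>) (\<tau>' \<^bold>\<and> \<chi>)"
        by (simp_all add: prov prov_hyp_conj prov_conj_iff)
      then have "R ((\<tau> \<^bold>\<and> \<tau>') \<^bold>\<and> \<chi>) (\<xi> \<^bold>\<and> \<xi>')" using \<tau>(2,4) by (meson conj trans)
      moreover have "\<tau> \<^bold>\<and> \<tau>' \<in> T" using filter \<tau>(1,3) by (simp add: deductive_filter_def)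
      ultimately show ?thesis unfolding U_def by blast
    qed
    then have "deductive_filter U"
      unfolding deductive_filter_def using TU by (auto simp: U_def intro: trans)
    moreover have "U \<inter> D = {}" using * by (auto simp: U_def)
    ultimately have "U \<in> A" using T TU by (auto simp: A_def)
    with max TU \<open>\<chi> \<notin> T\<close> show False by blast
  qed
  with T that show ?thesis by (auto simp: A_def)
qed

text \<open>The prime filter theorem for a distributive lattice, with the directed \<open>D\<close>
  as a base of the ideal to avoid: \<open>T\<close> is upward closed, so missing \<open>D\<close>
  means missing everything below it.\<close>

lemma prime_filter:
  assumes "\<And>\<delta>. \<delta> \<in> D \<Longrightarrow> \<not> R \<phi> \<delta>"
    and directed: "\<And>\<alpha> \<beta>. \<alpha> \<in> D \<Longrightarrow> \<beta> \<in> D \<Longrightarrow> \<exists>\<gamma> \<in> D. R \<alpha> \<gamma> \<and> R \<beta> \<gamma>"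
  obtains T where "deductive_filter T" "\<phi> \<in> T" "T \<inter> D = {}"
    "\<And>\<chi> \<xi>. \<chi> \<^bold>\<squnion> \<xi> \<in> T \<Longrightarrow> \<chi> \<in> T \<or> \<xi> \<in> T"
proof -
  obtain T where T: "deductive_filter T" "\<phi> \<in> T" "T \<inter> D = {}"
    and max: "\<And>\<chi>. \<chi> \<notin> T \<Longrightarrow> \<exists>\<tau> \<in> T. \<exists>\<delta> \<in> D. R (\<tau> \<^bold>\<and> \<chi>) \<delta>"
    using maximal_filter[OF assms(1)] by blast
  have "\<chi> \<in> T \<or> \<xi> \<in> T" if disj_in: "\<chi> \<^bold>\<squnion> \<xi> \<in> T" for \<chi> \<xi>
  proof (rule ccontr)
    assume "\<not> (\<chi> \<in> T \<or> \<xi> \<in> T)"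
    then obtain \<tau> \<delta> \<tau>' \<delta>' where \<tau>: "\<tau> \<in> T" "\<delta> \<in> D" "R (\<tau> \<^bold>\<and> \<chi>) \<delta>" "\<tau>' \<in> T" "\<delta>' \<in> D" "R (\<tau>' \<^bold>\<and> \<xi>) \<delta>'"
      using max by metis
    \<comment> \<open>Each disjunct outside \<open>T\<close> would lead from \<open>T\<close> into
      \<open>D\<close>, at \<delta> and \<delta>' respectively. With a common upper bound \<gamma>
      in \<open>D\<close>, distributivity puts \<gamma> itself into \<open>T\<close>.\<close>
    obtain \<gamma> where \<gamma>: "\<gamma> \<in> D" "R \<delta> \<gamma>" "R \<delta>' \<gamma>" using directed \<tau>(2,5) by blast
    have "R ((\<chi> \<^bold>\<squnion> \<xi>) \<^bold>\<and> \<tau> \<^bold>\<and> \<tau>') ((\<tau> \<^bold>\<and> \<chi>) \<^bold>\<squnion> (\<tau>' \<^bold>\<and> \<xi>))"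
      by (rule prov)
        (simp add: prov_hyp_conj prov_hyp_disj prov_conj_iff prov_disjI1 prov_disjI2
          insert_commute[of \<chi> "\<tau> \<^bold>\<and> \<tau>'"] insert_commute[of \<xi> "\<tau> \<^bold>\<and> \<tau>'"])
    moreover have "R ((\<tau> \<^bold>\<and> \<chi>) \<^bold>\<squnion> (\<tau>' \<^bold>\<and> \<xi>)) \<gamma>"
      using disj trans \<gamma>(2,3) \<tau>(3,6) by blast
    ultimately have "R ((\<chi> \<^bold>\<squnion> \<xi>) \<^bold>\<and> \<tau> \<^bold>\<and> \<tau>') \<gamma>" by (rule trans)
    moreover have "(\<chi> \<^bold>\<squnion> \<xi>) \<^bold>\<and> \<tau> \<^bold>\<and> \<tau>' \<in> T"
      using T(1) disj_in \<tau>(1,4) by (simp add: deductive_filter_def)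
    ultimately have "\<gamma> \<in> T" using T(1) unfolding deductive_filter_def by blast
    with \<gamma>(1) T(3) show False by blast
  qed
  with T that show ?thesis by blast
qed

end

lemma entailment_prov: "entailment \<Lambda> (\<lambda>\<phi> \<psi>. prov \<Lambda> (insert \<phi> X) \<psi>)"
proof
  fix \<phi> \<psi> \<chi> :: "'a form"
  show "prov \<Lambda> (insert \<phi> X) \<psi>" if "prov \<Lambda> {\<phi>} \<psi>"
    using that by (rule prov_mono) simp
  show "prov \<Lambda> (insert \<phi> X) \<chi>" if "prov \<Lambda> (insert \<phi> X) \<psi>" "prov \<Lambda> (insert \<psi> X) \<chi>"
    using that(2) by (rule prov_cut) (use that(1) in \<open>auto simp: hyp\<close>)
qed (simp_all add: prov_conj_iff prov_hyp_disj)

section \<open>The canonical model\<close>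

definition world :: "frame_condition set \<Rightarrow> 'p form set \<Rightarrow> bool" where
  "world \<Lambda> \<Gamma> \<longleftrightarrow> (\<forall>\<phi>. prov \<Lambda> \<Gamma> \<phi> \<longrightarrow> \<phi> \<in> \<Gamma>) \<and> \<^bold>\<bottom> \<notin> \<Gamma> \<and> (\<forall>\<phi>. \<phi> \<in> \<Gamma> \<or> \<^bold>\<not> \<phi> \<in> \<Gamma>)"

lemma world_prov_iff: "world \<Lambda> \<Gamma> \<Longrightarrow> prov \<Lambda> \<Gamma> \<phi> \<longleftrightarrow> \<phi> \<in> \<Gamma>"
  by (auto simp: world_def intro: hyp)

text \<open>Lindenbaum's lemma as the instance of \<open>maximal_filter\<close> that avoids falsum:
  by maximality a formula outside the filter is refuted from the filter and \<open>X\<close>, which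
  puts its negation in.\<close>

lemma world_extension:
  assumes "\<not> prov \<Lambda> X \<^bold>\<bottom>"
  obtains \<Gamma> where "world \<Lambda> \<Gamma>" "X \<subseteq> \<Gamma>"
proof -
  interpret entailment \<Lambda> "\<lambda>\<phi> \<psi>. prov \<Lambda> (insert \<phi> X) \<psi>" by (rule entailment_prov)
  \<comment> \<open>Verum serves as the initial formula of the filter. The hypotheses
    \<open>X\<close> are built into the relation, so they lie above verum and end up in the
    filter.\<close>
  have "\<not> prov \<Lambda> (insert \<^bold>\<top> X) \<^bold>\<bottom>"
    using assms by (simp add: prov_hyp_verum)
  then obtain T where T: "deductive_filter T" "\<^bold>\<top> \<in> T" "\<^bold>\<bottom> \<notin> T"
    and max: "\<And>\<chi>. \<chi> \<notin> T \<Longrightarrow> \<exists>\<tau> \<in> T. prov \<Lambda> (insert (\<tau> \<^bold>\<and> \<chi>) X) \<^bold>\<bottom>"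
    using maximal_filter[of "{\<^bold>\<bottom>}" "\<^bold>\<top>"] by auto
  have X: "X \<subseteq> T"
    using T(1,2) hyp unfolding deductive_filter_def by blast
  have "\<^bold>\<not> \<chi> \<in> T" if "\<chi> \<notin> T" for \<chi>
  proof -
    obtain \<tau> where \<tau>: "\<tau> \<in> T" "prov \<Lambda> (insert \<tau> (insert \<chi> X)) \<^bold>\<bottom>"
      using max[OF \<open>\<chi> \<notin> T\<close>] by (auto simp: prov_hyp_conj)
    have "prov \<Lambda> (insert \<chi> T) \<^bold>\<bottom>"
      using \<tau>(2) by (rule prov_mono) (use X \<tau>(1) in auto)
    then show ?thesis
      by (intro deductive_filter_closed[OF T(1)]) (simp add: prov_neg_iff)
  qed
  then have "world \<Lambda> T"
    unfolding world_def using T(3) deductive_filter_closed[OF T(1)] by blast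
  then show ?thesis using X that by blast
qed

text \<open>Reductio for the declarative \<alpha> makes \<open>X\<close> consistent with the
  negation of \<alpha>, and \<open>world_extension\<close> applies.\<close>

lemma world_separation:
  assumes "declarative \<alpha>" "\<not> prov \<Lambda> X \<alpha>"
  obtains \<Gamma> where "world \<Lambda> \<Gamma>" "X \<subseteq> \<Gamma>" "\<alpha> \<notin> \<Gamma>"
proof -
  have "\<not> prov \<Lambda> (insert (\<^bold>\<not> \<alpha>) X) \<^bold>\<bottom>" using assms prov_by_contradiction by blast
  then obtain \<Gamma> where \<Gamma>: "world \<Lambda> \<Gamma>" "insert (\<^bold>\<not> \<alpha>) X \<subseteq> \<Gamma>" by (rule world_extension)
  have "\<alpha> \<notin> \<Gamma>"
  proof
    assume "\<alpha> \<in> \<Gamma>"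
    then have "prov \<Lambda> \<Gamma> \<^bold>\<bottom>"
      using \<Gamma>(2) by (intro prov_mono[OF prov_neg_hyp[of \<Lambda> \<alpha> "{}"]]) auto
    then show False using \<Gamma>(1) by (auto simp: world_def)
  qed
  with \<Gamma> that show ?thesis by blast
qed

abbreviation msupports :: "'p form set set \<Rightarrow> 'p form \<Rightarrow> bool" where
  "msupports \<equiv> psupports (\<lambda>\<Gamma> \<phi>. \<phi> \<in> \<Gamma>)"

text \<open>At a singleton all clauses are classical, and negation completeness of the world
  supplies the matching closure for implication and inquisitive disjunction. Atoms and conditionals
  hold by the choice of valuation.\<close>

lemma msupports_world:
  assumes "world \<Lambda> \<Gamma>"
  shows "msupports {\<Gamma>} \<phi> \<longleftrightarrow> \<phi> \<in> \<Gamma>"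
proof (induction \<phi>)
  case Falsum
  show ?case using assms by (simp add: world_def)
next
  case (Conj \<phi> \<psi>)
  then show ?case using prov_conj_iff[of \<Lambda> \<Gamma>] by (simp add: world_prov_iff[OF assms])
next
  case (Impl \<phi> \<psi>)
  have "(\<phi> \<^bold>\<rightarrow> \<psi>) \<in> \<Gamma>" if "\<phi> \<notin> \<Gamma>"
  proof -
    have "\<^bold>\<not> \<phi> \<in> \<Gamma>" using that assms by (auto simp: world_def)
    then have "prov \<Lambda> \<Gamma> (\<phi> \<^bold>\<rightarrow> \<psi>)"
      using prov_neg_hyp[of \<Lambda> \<phi> \<Gamma> \<psi>] by (simp add: prov_imp_iff insert_absorb)
    then show ?thesis by (simp add: world_prov_iff[OF assms])
  qed
  moreover have "(\<phi> \<^bold>\<rightarrow> \<psi>) \<in> \<Gamma>" if "\<psi> \<in> \<Gamma>"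
    using prov_K[of \<Lambda> \<Gamma> \<psi> \<phi>] that by (simp add: world_prov_iff[OF assms])
  moreover have "\<psi> \<in> \<Gamma>" if "(\<phi> \<^bold>\<rightarrow> \<psi>) \<in> \<Gamma>" "\<phi> \<in> \<Gamma>"
    using mp[of \<Lambda> \<Gamma> \<phi> \<psi>] that by (simp add: world_prov_iff[OF assms])
  ultimately show ?case using Impl by (auto simp del: psupports.simps)
next
  case (InqDisj \<phi> \<psi>)
  have "\<phi> \<in> \<Gamma> \<or> \<psi> \<in> \<Gamma>" if "\<phi> \<^bold>\<squnion> \<psi> \<in> \<Gamma>"
  proof (rule ccontr)
    assume "\<not> (\<phi> \<in> \<Gamma> \<or> \<psi> \<in> \<Gamma>)"
    then have "prov \<Lambda> \<Gamma> (\<^bold>\<not> \<phi>)" "prov \<Lambda> \<Gamma> (\<^bold>\<not> \<psi>)"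
      using assms by (auto simp: world_def intro: hyp)
    then have "prov \<Lambda> \<Gamma> \<^bold>\<bottom>"
      using prov_disjE[OF hyp[OF that]] by (simp add: prov_neg_iff)
    then show False using assms by (auto simp: world_def)
  qed
  then show ?case
    using InqDisj prov_disjI1[of \<Lambda> \<Gamma>] prov_disjI2[of \<Lambda> \<Gamma>]
    by (auto simp: world_prov_iff[OF assms])
qed simp_all

lemma world_disj_iff: "world \<Lambda> \<Gamma> \<Longrightarrow> \<phi> \<^bold>\<or> \<psi> \<in> \<Gamma> \<longleftrightarrow> \<phi> \<in> \<Gamma> \<or> \<psi> \<in> \<Gamma>"
  by (simp add: msupports_world[symmetric] Disj_def)

lemma world_neg_iff: "world \<Lambda> \<Gamma> \<Longrightarrow> \<^bold>\<not> \<phi> \<in> \<Gamma> \<longleftrightarrow> \<phi> \<notin> \<Gamma>"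
  by (simp add: msupports_world[symmetric])

lemma world_derivable: "world \<Lambda> \<Gamma> \<Longrightarrow> derivable \<Lambda> \<phi> \<Longrightarrow> \<phi> \<in> \<Gamma>"
  using ax world_prov_iff by blast

lemma world_mp: "world \<Lambda> \<Gamma> \<Longrightarrow> derivable \<Lambda> (\<phi> \<^bold>\<rightarrow> \<psi>) \<Longrightarrow> \<phi> \<in> \<Gamma> \<Longrightarrow> \<psi> \<in> \<Gamma>"
  using mp[OF ax hyp] world_prov_iff by blast

lemma world_conj_iff: "world \<Lambda> \<Gamma> \<Longrightarrow> \<phi> \<^bold>\<and> \<psi> \<in> \<Gamma> \<longleftrightarrow> \<phi> \<in> \<Gamma> \<and> \<psi> \<in> \<Gamma>"
  by (simp add: msupports_world[symmetric])

text \<open>\<open>Trans\<close>, \<open>RConj\<close> and \<open>LDisj\<close> give three of the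
  locale assumptions, and conditional necessitation gives the one about \<open>prov\<close>.\<close>

lemma entailment_world:
  assumes "world \<Lambda> \<Gamma>"
  shows "entailment \<Lambda> (\<lambda>\<phi> \<psi>. (\<phi> \<Rrightarrow> \<psi>) \<in> \<Gamma>)"
proof
  fix \<phi> \<psi> \<chi> :: "'a form"
  show "(\<phi> \<Rrightarrow> \<psi>) \<in> \<Gamma>" if "prov \<Lambda> {\<phi>} \<psi>"
    by (rule world_derivable[OF assms CondNec]) (simp add: that derivable_imp_iff)
  show "(\<phi> \<Rrightarrow> \<chi>) \<in> \<Gamma>" if "(\<phi> \<Rrightarrow> \<psi>) \<in> \<Gamma>" "(\<psi> \<Rrightarrow> \<chi>) \<in> \<Gamma>"
    by (rule world_mp[OF assms Trans[of \<Lambda> \<phi> \<psi>]]) (simp add: that world_conj_iff[OF assms])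
  show "(\<phi> \<Rrightarrow> \<psi> \<^bold>\<and> \<chi>) \<in> \<Gamma>" if "(\<phi> \<Rrightarrow> \<psi>) \<in> \<Gamma>" "(\<phi> \<Rrightarrow> \<chi>) \<in> \<Gamma>"
    by (rule world_mp[OF assms RConj]) (simp add: that world_conj_iff[OF assms])
  show "(\<phi> \<^bold>\<squnion> \<psi> \<Rrightarrow> \<chi>) \<in> \<Gamma>" if "(\<phi> \<Rrightarrow> \<chi>) \<in> \<Gamma>" "(\<psi> \<Rrightarrow> \<chi>) \<in> \<Gamma>"
    by (rule world_mp[OF assms LDisj]) (simp add: that world_conj_iff[OF assms])
qed

lemma msupports_derivable:
  assumes "derivable \<Lambda> \<phi>" "s \<subseteq> Collect (world \<Lambda>)"
  shows "msupports s \<phi>"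
  using assms
proof (rule psupports_derivable)
  fix \<Gamma> :: "'a form set" assume "\<Gamma> \<in> Collect (world \<Lambda>)"
  then have \<Gamma>: "world \<Lambda> \<Gamma>" by simp
  interpret entailment \<Lambda> "\<lambda>\<phi> \<psi>. (\<phi> \<Rrightarrow> \<psi>) \<in> \<Gamma>" by (rule entailment_world[OF \<Gamma>])
  show "(\<phi> \<Rrightarrow> \<chi>) \<in> \<Gamma>" if "(\<phi> \<Rrightarrow> \<psi>) \<in> \<Gamma>" "(\<psi> \<Rrightarrow> \<chi>) \<in> \<Gamma>" for \<phi> \<psi> \<chi>
    using that by (rule trans)
  show "(\<phi> \<Rrightarrow> \<psi> \<^bold>\<and> \<chi>) \<in> \<Gamma>" if "(\<phi> \<Rrightarrow> \<psi>) \<in> \<Gamma>" "(\<phi> \<Rrightarrow> \<chi>) \<in> \<Gamma>" for \<phi> \<psi> \<chi>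
    using that by (rule conj)
  show "(\<phi> \<^bold>\<squnion> \<psi> \<Rrightarrow> \<chi>) \<in> \<Gamma>" if "(\<phi> \<Rrightarrow> \<chi>) \<in> \<Gamma>" "(\<psi> \<Rrightarrow> \<chi>) \<in> \<Gamma>" for \<phi> \<psi> \<chi>
    using that by (rule disj)
  show "msupports {\<Gamma>} \<phi>" if "c \<in> \<Lambda>" "\<phi> \<in> schema c" for c \<phi>
    using that by (simp add: msupports_world[OF \<Gamma>] world_derivable[OF \<Gamma>] derivable.Schema)
  show "(\<phi> \<Rrightarrow> \<psi>) \<in> \<Gamma>" if "derivable \<Lambda> (\<phi> \<^bold>\<rightarrow> \<psi>)" for \<phi> \<psi>
    using that by (simp add: prov derivable_imp_iff)
qed

lemma msupports_prov:
  assumes "prov \<Lambda> {\<phi>} \<psi>" "s \<subseteq> Collect (world \<Lambda>)" "msupports s \<phi>"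
  shows "msupports s \<psi>"
  using msupports_derivable[of \<Lambda> "\<phi> \<^bold>\<rightarrow> \<psi>" s] assms by (simp add: derivable_imp_iff)

text \<open>Declaratives are decided by the worlds extending \<open>T\<close>, since one that
  \<open>T\<close> does not prove is missing from some extension. Primeness gives the disjunctions,
  and both sides are invariant under provable equivalence.\<close>

lemma msupports_prime:
  assumes closed: "\<And>\<phi>. prov \<Lambda> T \<phi> \<Longrightarrow> \<phi> \<in> T"
    and prime: "\<And>\<phi> \<psi>. \<phi> \<^bold>\<squnion> \<psi> \<in> T \<Longrightarrow> \<phi> \<in> T \<or> \<psi> \<in> T"
  shows "msupports {\<Gamma>. world \<Lambda> \<Gamma> \<and> T \<subseteq> \<Gamma>} \<phi> \<longleftrightarrow> \<phi> \<in> T"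
proof (induction \<phi> rule: resolution_induct[where \<Lambda> = \<Lambda>])
  case (declarative \<alpha>)
  have "\<alpha> \<in> T" if "\<And>\<Gamma>. world \<Lambda> \<Gamma> \<Longrightarrow> T \<subseteq> \<Gamma> \<Longrightarrow> \<alpha> \<in> \<Gamma>"
    using that world_separation[OF declarative, of \<Lambda> T] closed by metis
  then show ?case
    using psupports_truth_conditional[OF declarative, of "\<lambda>\<Gamma> \<phi>. \<phi> \<in> \<Gamma>" "{\<Gamma>. world \<Lambda> \<Gamma> \<and> T \<subseteq> \<Gamma>}"]
      msupports_world[of \<Lambda> _ \<alpha>]
    by blast
next
  case (disj \<phi> \<psi>)
  have "\<phi> \<^bold>\<squnion> \<psi> \<in> T" if "\<phi> \<in> T \<or> \<psi> \<in> T"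
    using that by (intro closed) (auto intro: hyp prov_disjI1 prov_disjI2)
  with disj show ?case using prime by auto
next
  case (equiv \<phi> \<psi>)
  have "\<phi> \<in> T \<longleftrightarrow> \<psi> \<in> T"
    using equiv.hyps(2) closed prov_mono[of \<Lambda> "{_}" _ T] by (auto simp: equivalent_def)
  moreover have "msupports s \<phi> \<longleftrightarrow> msupports s \<psi>" if "s \<subseteq> Collect (world \<Lambda>)" for s
    using equiv.hyps(2) msupports_prov that by (auto simp: equivalent_def)
  ultimately show ?case using equiv.IH by (auto simp: subset_iff)
qed

section \<open>Canonical neighbourhoods and the truth lemma\<close>

definition canonical_nbhds :: "frame_condition set \<Rightarrow> 'p form set \<Rightarrow> 'p form set set set" where
  "canonical_nbhds \<Lambda> \<Gamma> = {s. s \<noteq> {} \<and> s \<subseteq> Collect (world \<Lambda>) \<and>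
     (\<forall>\<phi> \<psi>. (\<phi> \<Rrightarrow> \<psi>) \<in> \<Gamma> \<longrightarrow> msupports s \<phi> \<longrightarrow> msupports s \<psi>)}"

definition canonical_model :: "frame_condition set \<Rightarrow> ('p form set, 'p) in_model" where
  "canonical_model \<Lambda> =
     \<lparr>worlds = Collect (world \<Lambda>), nbhds = canonical_nbhds \<Lambda>, val = (\<lambda>\<Gamma> p. Atom p \<in> \<Gamma>)\<rparr>"

lemma canonical_model_simps [simp]:
  "worlds (canonical_model \<Lambda>) = Collect (world \<Lambda>)"
  "nbhds (canonical_model \<Lambda>) = canonical_nbhds \<Lambda>"
  "val (canonical_model \<Lambda>) = (\<lambda>\<Gamma> p. Atom p \<in> \<Gamma>)"
  by (simp_all add: canonical_model_def)

text \<open>A prime filter for the preorder given by \<Gamma> is closed under the conditionals in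
  \<Gamma>, which is what makes the state of its extensions a neighbourhood. The set
  \<open>D\<close> is kept general because the truth lemma has one formula to avoid and reflexivity
  a whole set.\<close>

lemma canonical_nbhd_extension:
  assumes \<Gamma>: "world \<Lambda> \<Gamma>" and "D \<noteq> {}" "\<And>\<delta>. \<delta> \<in> D \<Longrightarrow> (\<phi> \<Rrightarrow> \<delta>) \<notin> \<Gamma>"
    and "\<And>\<alpha> \<beta>. \<alpha> \<in> D \<Longrightarrow> \<beta> \<in> D \<Longrightarrow> \<exists>\<gamma> \<in> D. (\<alpha> \<Rrightarrow> \<gamma>) \<in> \<Gamma> \<and> (\<beta> \<Rrightarrow> \<gamma>) \<in> \<Gamma>"
  obtains T where "\<phi> \<in> T" "T \<inter> D = {}" "{\<Delta>. world \<Lambda> \<Delta> \<and> T \<subseteq> \<Delta>} \<in> canonical_nbhds \<Lambda> \<Gamma>"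
    "\<And>\<chi>. msupports {\<Delta>. world \<Lambda> \<Delta> \<and> T \<subseteq> \<Delta>} \<chi> \<longleftrightarrow> \<chi> \<in> T"
proof -
  interpret entailment \<Lambda> "\<lambda>\<phi> \<psi>. (\<phi> \<Rrightarrow> \<psi>) \<in> \<Gamma>" by (rule entailment_world[OF \<Gamma>])
  obtain T where T: "deductive_filter T" "\<phi> \<in> T" "T \<inter> D = {}"
    and prime: "\<And>\<chi> \<xi>. \<chi> \<^bold>\<squnion> \<xi> \<in> T \<Longrightarrow> \<chi> \<in> T \<or> \<xi> \<in> T"
    using prime_filter[OF assms(3,4)] by blast
  let ?s = "{\<Delta>. world \<Lambda> \<Delta> \<and> T \<subseteq> \<Delta>}"
  have s: "msupports ?s \<chi> \<longleftrightarrow> \<chi> \<in> T" for \<chi>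
    using msupports_prime[OF deductive_filter_closed[OF T(1)] prime] .
  have "\<^bold>\<bottom> \<notin> T"
    using T(1,3) \<open>D \<noteq> {}\<close> deductive_filter_closed prov_falsum[OF hyp] by blast
  \<comment> \<open>A filter with falsum would contain all formulas and meet the nonempty
    \<open>D\<close>; only the empty state supports falsum.\<close>
  then have "?s \<noteq> {}" using s[of "\<^bold>\<bottom>"] by simp
  moreover have "\<xi> \<in> T" if "(\<chi> \<Rrightarrow> \<xi>) \<in> \<Gamma>" "\<chi> \<in> T" for \<chi> \<xi>
    using T(1) that unfolding deductive_filter_def by blast
  ultimately have "?s \<in> canonical_nbhds \<Lambda> \<Gamma>"
    unfolding canonical_nbhds_def by (auto simp: s)
  with T s that show ?thesis by blast
qed

lemma canonical_nbhd_exists: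
  assumes \<Gamma>: "world \<Lambda> \<Gamma>" and "(\<phi> \<Rrightarrow> \<psi>) \<notin> \<Gamma>"
  obtains s where "s \<in> canonical_nbhds \<Lambda> \<Gamma>" "msupports s \<phi>" "\<not> msupports s \<psi>"
proof -
  \<comment> \<open>This makes the singleton \<open>{\<psi>}\<close> directed.\<close>
  have "(\<psi> \<Rrightarrow> \<psi>) \<in> \<Gamma>"
    by (rule world_derivable[OF \<Gamma> CondNec]) (simp add: derivable_imp_iff)
  with assms(2) obtain T where "\<phi> \<in> T" "T \<inter> {\<psi>} = {}"
    "{\<Delta>. world \<Lambda> \<Delta> \<and> T \<subseteq> \<Delta>} \<in> canonical_nbhds \<Lambda> \<Gamma>"
    "\<And>\<chi>. msupports {\<Delta>. world \<Lambda> \<Delta> \<and> T \<subseteq> \<Delta>} \<chi> \<longleftrightarrow> \<chi> \<in> T"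
    using canonical_nbhd_extension[OF \<Gamma>, of "{\<psi>}" \<phi>] by auto
  with that show ?thesis by auto
qed

text \<open>At a conditional the definition of \<open>canonical_nbhds\<close> gives one direction
  and \<open>canonical_nbhd_exists\<close> the other; the remaining clauses coincide.\<close>

lemma supports_canonical_model:
  "s \<subseteq> Collect (world \<Lambda>) \<Longrightarrow> supports (canonical_model \<Lambda>) s \<phi> \<longleftrightarrow> msupports s \<phi>"
proof (induction \<phi> arbitrary: s)
  case (Impl \<phi> \<psi>)
  then have "supports (canonical_model \<Lambda>) t \<phi> \<longleftrightarrow> msupports t \<phi>"
    "supports (canonical_model \<Lambda>) t \<psi> \<longleftrightarrow> msupports t \<psi>" if "t \<subseteq> s" for t
    using that by blast+
  then show ?case by simp
next
  case (Cond \<phi> \<psi>)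
  have "supports (canonical_model \<Lambda>) t \<phi> \<longleftrightarrow> msupports t \<phi>"
    "supports (canonical_model \<Lambda>) t \<psi> \<longleftrightarrow> msupports t \<psi>"
    if "t \<in> canonical_nbhds \<Lambda> \<Gamma>" for t \<Gamma>
    using that by (auto simp: canonical_nbhds_def Cond.IH)
  moreover have "(\<phi> \<Rrightarrow> \<psi>) \<in> \<Gamma> \<longleftrightarrow> (\<forall>t \<in> canonical_nbhds \<Lambda> \<Gamma>. msupports t \<phi> \<longrightarrow> msupports t \<psi>)"
    if "\<Gamma> \<in> s" for \<Gamma>
  proof
    assume "\<forall>t \<in> canonical_nbhds \<Lambda> \<Gamma>. msupports t \<phi> \<longrightarrow> msupports t \<psi>"
    then show "(\<phi> \<Rrightarrow> \<psi>) \<in> \<Gamma>"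
      using canonical_nbhd_exists[of \<Lambda> \<Gamma> \<phi> \<psi>] that Cond.prems by blast
  qed (auto simp: canonical_nbhds_def)
  ultimately show ?case by simp
qed simp_all

section \<open>Frame conditions of the canonical model\<close>

lemma msupports_verum: "msupports s \<^bold>\<top>"
  by (simp add: Verum_def)

lemma msupports_box: "\<^bold>\<box> \<phi> \<in> \<Gamma> \<Longrightarrow> s \<in> canonical_nbhds \<Lambda> \<Gamma> \<Longrightarrow> msupports s \<phi>"
  unfolding Box_def canonical_nbhds_def using msupports_verum by blast

text \<open>In a supported disjunction one follows a supported disjunct until a declarative is
  reached. Antecedents can thereby be replaced by truth-conditional ones.\<close>

lemma msupports_resolution:
  assumes "s \<subseteq> Collect (world \<Lambda>)" "msupports s \<phi>"
  obtains \<alpha> where "declarative \<alpha>" "prov \<Lambda> {\<alpha>} \<phi>" "msupports s \<alpha>"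
proof -
  have "msupports s \<phi> \<longrightarrow> (\<exists>\<alpha>. declarative \<alpha> \<and> prov \<Lambda> {\<alpha>} \<phi> \<and> msupports s \<alpha>)"
  proof (induction \<phi> rule: resolution_induct[where \<Lambda> = \<Lambda>])
    case (disj \<phi> \<psi>)
    then show ?case by (auto intro: prov_disjI1 prov_disjI2)
  next
    case (equiv \<phi> \<psi>)
    have "prov \<Lambda> {\<alpha>} \<psi>" if "prov \<Lambda> {\<alpha>} \<phi>" for \<alpha>
      by (rule prov_cut[of _ "{\<phi>}"]) (use that equiv.hyps(2) in \<open>auto simp: equivalent_def\<close>)
    moreover have "msupports s \<psi> \<longrightarrow> msupports s \<phi>"
      using equiv.hyps(2) msupports_prov assms(1) by (auto simp: equivalent_def)
    ultimately show ?case using equiv.IH by blast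
  qed (use prov_hyps(1) in blast)
  with assms(2) that show ?thesis by blast
qed

text \<open>The union-closure schema splits a conditional with declarative antecedent along
  disjunctions in the consequent, and a world containing a classical disjunction contains one of its
  disjuncts.\<close>

lemma cond_resolution:
  assumes \<Gamma>: "world \<Lambda> \<Gamma>" and "Finite_Union_Closure \<in> \<Lambda>" "declarative \<alpha>" "(\<alpha> \<Rrightarrow> \<psi>) \<in> \<Gamma>"
  obtains \<beta> where "declarative \<beta>" "prov \<Lambda> {\<beta>} \<psi>" "(\<alpha> \<Rrightarrow> \<beta>) \<in> \<Gamma>"
proof -
  interpret entailment \<Lambda> "\<lambda>\<phi> \<psi>. (\<phi> \<Rrightarrow> \<psi>) \<in> \<Gamma>" by (rule entailment_world[OF \<Gamma>])
  have "(\<alpha> \<Rrightarrow> \<psi>) \<in> \<Gamma> \<longrightarrow> (\<exists>\<beta>. declarative \<beta> \<and> prov \<Lambda> {\<beta>} \<psi> \<and> (\<alpha> \<Rrightarrow> \<beta>) \<in> \<Gamma>)"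
  proof (induction \<psi> rule: resolution_induct[where \<Lambda> = \<Lambda>])
    case (disj \<phi> \<psi>)
    have "derivable \<Lambda> ((\<alpha> \<Rrightarrow> \<phi> \<^bold>\<squnion> \<psi>) \<^bold>\<rightarrow> (\<alpha> \<Rrightarrow> \<phi>) \<^bold>\<or> (\<alpha> \<Rrightarrow> \<psi>))"
      using assms(2,3) by (intro Schema) auto
    from world_mp[OF \<Gamma> this] have "(\<alpha> \<Rrightarrow> \<phi> \<^bold>\<squnion> \<psi>) \<in> \<Gamma> \<longrightarrow> (\<alpha> \<Rrightarrow> \<phi>) \<in> \<Gamma> \<or> (\<alpha> \<Rrightarrow> \<psi>) \<in> \<Gamma>"
      by (simp add: world_disj_iff[OF \<Gamma>])
    with disj.IH show ?case by (blast intro: prov_disjI1 prov_disjI2)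
  next
    case (equiv \<phi> \<psi>)
    have "prov \<Lambda> {\<beta>} \<psi>" if "prov \<Lambda> {\<beta>} \<phi>" for \<beta>
      by (rule prov_cut[of _ "{\<phi>}"]) (use that equiv.hyps(2) in \<open>auto simp: equivalent_def\<close>)
    moreover have "(\<alpha> \<Rrightarrow> \<psi>) \<in> \<Gamma> \<longrightarrow> (\<alpha> \<Rrightarrow> \<phi>) \<in> \<Gamma>"
      using equiv.hyps(2) prov trans by (auto simp: equivalent_def)
    ultimately show ?case using equiv.IH by blast
  qed (use prov_hyps(1) in blast)
  with assms(4) that show ?thesis by blast
qed

lemma satisfies_canonical_model:
  assumes "c \<in> \<Lambda>"
  shows "satisfies (canonical_model \<Lambda>) c"
proof -
  have schema: "\<psi> \<in> \<Gamma>" if "world \<Lambda> \<Gamma>" "\<phi> \<^bold>\<rightarrow> \<psi> \<in> schema c" "\<phi> \<in> \<Gamma>" for \<Gamma> \<phi> \<psi>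
    using world_mp[OF that(1) Schema[OF assms that(2)] that(3)] .
  \<comment> \<open>A formula boxed in \<Gamma> is supported by every neighbourhood of \<Gamma>, and
    persistence carries it to the single worlds there.\<close>
  have member: "\<alpha> \<in> \<Delta>"
    if "\<^bold>\<box> \<alpha> \<in> \<Gamma>" "s \<in> canonical_nbhds \<Lambda> \<Gamma>" "\<Delta> \<in> s" "world \<Lambda> \<Delta>" for \<alpha> \<Gamma> \<Delta> s
    using psupports_persistent[OF msupports_box[OF that(1,2)], of "{\<Delta>}"] that(3)
    by (simp add: msupports_world[OF that(4)])
  show ?thesis
  proof (cases c)
    case Downward_Monotonicity
    have "t \<in> canonical_nbhds \<Lambda> \<Gamma>"
      if \<Gamma>: "world \<Lambda> \<Gamma>" and t: "t \<noteq> {}" "t \<subseteq> s" and s: "s \<in> canonical_nbhds \<Lambda> \<Gamma>" for \<Gamma> s t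
    proof -
      \<comment> \<open>The schema turns the conditional into a boxed implication; \<open>s\<close>
        supports it, and support of an implication quantifies over substates such as
        \<open>t\<close>.\<close>
      have "msupports t \<psi>" if "(\<phi> \<Rrightarrow> \<psi>) \<in> \<Gamma>" "msupports t \<phi>" for \<phi> \<psi>
      proof -
        have "\<^bold>\<box> (\<phi> \<^bold>\<rightarrow> \<psi>) \<in> \<Gamma>"
          by (rule schema[OF \<Gamma> _ that(1)]) (simp add: Downward_Monotonicity)
        from msupports_box[OF this s] that(2) t(2) show ?thesis by simp
      qed
      then show ?thesis using t s by (auto simp: canonical_nbhds_def)
    qed
    then show ?thesis by (simp add: Downward_Monotonicity) blast
  next
    case Finite_Union_Closure
    have "s \<union> t \<in> canonical_nbhds \<Lambda> \<Gamma>"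
      if \<Gamma>: "world \<Lambda> \<Gamma>" and s: "s \<in> canonical_nbhds \<Lambda> \<Gamma>" and t: "t \<in> canonical_nbhds \<Lambda> \<Gamma>" for \<Gamma> s t
    proof -
      interpret entailment \<Lambda> "\<lambda>\<phi> \<psi>. (\<phi> \<Rrightarrow> \<psi>) \<in> \<Gamma>" by (rule entailment_world[OF \<Gamma>])
      have st: "s \<union> t \<subseteq> Collect (world \<Lambda>)" using s t by (auto simp: canonical_nbhds_def)
      \<comment> \<open>Declaratives carry support across the union: \<phi> is replaced by a
        stronger \<alpha> that persists to \<open>s\<close> and \<open>t\<close>, and \<psi> by a
        stronger \<beta> whose support at both parts adds up to support at the union.\<close>
      have "msupports (s \<union> t) \<psi>" if "(\<phi> \<Rrightarrow> \<psi>) \<in> \<Gamma>" "msupports (s \<union> t) \<phi>" for \<phi> \<psi>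
      proof -
        obtain \<alpha> where \<alpha>: "declarative \<alpha>" "prov \<Lambda> {\<alpha>} \<phi>" "msupports (s \<union> t) \<alpha>"
          using msupports_resolution[OF st \<open>msupports (s \<union> t) \<phi>\<close>] .
        have "(\<alpha> \<Rrightarrow> \<psi>) \<in> \<Gamma>" using trans[OF prov[OF \<alpha>(2)] that(1)] .
        then obtain \<beta> where \<beta>: "declarative \<beta>" "prov \<Lambda> {\<beta>} \<psi>" "(\<alpha> \<Rrightarrow> \<beta>) \<in> \<Gamma>"
          using cond_resolution[OF \<Gamma> _ \<alpha>(1)] assms Finite_Union_Closure by blast
        have "msupports s \<alpha>" "msupports t \<alpha>"
          using psupports_persistent[OF \<alpha>(3)] by simp_all
        then have "msupports s \<beta>" "msupports t \<beta>"
          using s t \<beta>(3) by (auto simp: canonical_nbhds_def)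
        then have "msupports (s \<union> t) \<beta>"
          using psupports_truth_conditional[OF \<beta>(1)] by (metis Un_iff)
        then show ?thesis using msupports_prov[OF \<beta>(2) st] by blast
      qed
      then show ?thesis using st s by (auto simp: canonical_nbhds_def)
    qed
    then show ?thesis by (simp add: Finite_Union_Closure) blast
  next
    case Reflexivity
    have "\<exists>s \<in> canonical_nbhds \<Lambda> \<Gamma>. \<Gamma> \<in> s" if \<Gamma>: "world \<Lambda> \<Gamma>" for \<Gamma>
    proof -
      interpret entailment \<Lambda> "\<lambda>\<phi> \<psi>. (\<phi> \<Rrightarrow> \<psi>) \<in> \<Gamma>" by (rule entailment_world[OF \<Gamma>])
      \<comment> \<open>Avoiding the declaratives false at \<Gamma> will force the filter into
        \<Gamma>. The axiom ensures that no member of \<open>D\<close> lies above verum, and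
        classical disjunction, which preserves declaratives, makes \<open>D\<close>
        directed.\<close>
      define D where "D = {\<alpha>. declarative \<alpha> \<and> \<alpha> \<notin> \<Gamma>}"
      have D_nonempty: "D \<noteq> {}" using \<Gamma> by (auto simp: D_def world_def intro: exI[of _ "\<^bold>\<bottom>"])
      have D_avoid: "(\<^bold>\<top> \<Rrightarrow> \<delta>) \<notin> \<Gamma>" if "\<delta> \<in> D" for \<delta>
      proof
        assume "(\<^bold>\<top> \<Rrightarrow> \<delta>) \<in> \<Gamma>"
        then have "\<^bold>\<box> \<delta> \<in> \<Gamma>" by (simp add: Box_def)
        moreover have "\<^bold>\<box> \<delta> \<^bold>\<rightarrow> \<delta> \<in> schema c" using that Reflexivity by (simp add: D_def)
        ultimately have "\<delta> \<in> \<Gamma>" using schema[OF \<Gamma>] by blast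
        then show False using that by (simp add: D_def)
      qed
      have D_directed: "\<exists>\<gamma> \<in> D. (\<alpha> \<Rrightarrow> \<gamma>) \<in> \<Gamma> \<and> (\<beta> \<Rrightarrow> \<gamma>) \<in> \<Gamma>" if "\<alpha> \<in> D" "\<beta> \<in> D" for \<alpha> \<beta>
      proof (intro bexI conjI)
        have "prov \<Lambda> {\<^bold>\<not> \<alpha>, \<^bold>\<not> \<beta>, \<alpha>} \<^bold>\<bottom>" "prov \<Lambda> {\<^bold>\<not> \<alpha>, \<^bold>\<not> \<beta>, \<beta>} \<^bold>\<bottom>"
          by (rule prov_mono[OF prov_neg_hyp[of \<Lambda> _ "{}"]], blast)+
        then show "(\<alpha> \<Rrightarrow> \<alpha> \<^bold>\<or> \<beta>) \<in> \<Gamma>" "(\<beta> \<Rrightarrow> \<alpha> \<^bold>\<or> \<beta>) \<in> \<Gamma>"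
          by (simp_all add: prov Disj_def prov_neg_iff[of _ _ "_ \<^bold>\<and> _"] prov_hyp_conj)
        show "\<alpha> \<^bold>\<or> \<beta> \<in> D"
          using that by (simp add: D_def world_disj_iff[OF \<Gamma>]) (simp add: Disj_def Neg_def)
      qed
      obtain T where "\<^bold>\<top> \<in> T" and T: "T \<inter> D = {}"
        "{\<Delta>. world \<Lambda> \<Delta> \<and> T \<subseteq> \<Delta>} \<in> canonical_nbhds \<Lambda> \<Gamma>"
        "\<And>\<chi>. msupports {\<Delta>. world \<Lambda> \<Delta> \<and> T \<subseteq> \<Delta>} \<chi> \<longleftrightarrow> \<chi> \<in> T"
        by (rule canonical_nbhd_extension[OF \<Gamma> D_nonempty D_avoid D_directed]) blast+
      \<comment> \<open>Each member of \<open>T\<close> follows from a declarative in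
        \<open>T\<close>, which is outside \<open>D\<close> and thus in \<Gamma>. Hence \<Gamma>
        itself belongs to the neighbourhood.\<close>
      have "T \<subseteq> \<Gamma>"
      proof
        fix \<phi> assume "\<phi> \<in> T"
        then have "msupports {\<Delta>. world \<Lambda> \<Delta> \<and> T \<subseteq> \<Delta>} \<phi>" by (simp add: T(3))
        then obtain \<alpha> where \<alpha>: "declarative \<alpha>" "prov \<Lambda> {\<alpha>} \<phi>" "\<alpha> \<in> T"
          using msupports_resolution[of "{\<Delta>. world \<Lambda> \<Delta> \<and> T \<subseteq> \<Delta>}" \<Lambda> \<phi>] by (auto simp: T(3))
        then have "\<alpha> \<in> \<Gamma>" using T(1) by (auto simp: D_def)
        then show "\<phi> \<in> \<Gamma>" using world_mp[OF \<Gamma>] \<alpha>(2) by (simp add: derivable_imp_iff)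
      qed
      with \<Gamma> have "\<Gamma> \<in> {\<Delta>. world \<Lambda> \<Delta> \<and> T \<subseteq> \<Delta>}" by simp
      then show ?thesis using T(2) by (rule bexI)
    qed
    then show ?thesis by (simp add: Reflexivity) blast
  next
    case Non_Triviality
    have "canonical_nbhds \<Lambda> \<Gamma> \<noteq> {}" if \<Gamma>: "world \<Lambda> \<Gamma>" for \<Gamma>
    proof -
      have "\<^bold>\<not> (\<^bold>\<box> \<^bold>\<bottom>) \<in> \<Gamma>"
        using Non_Triviality assms by (intro world_derivable[OF \<Gamma> Schema]) auto
      then have "(\<^bold>\<top> \<Rrightarrow> \<^bold>\<bottom>) \<notin> \<Gamma>" by (simp add: world_neg_iff[OF \<Gamma>] Box_def)
      then show ?thesis using canonical_nbhd_exists[OF \<Gamma>] by blast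
    qed
    then show ?thesis by (simp add: Non_Triviality) blast
  next
    case Decreasingness
    have "canonical_nbhds \<Lambda> \<Delta> \<subseteq> canonical_nbhds \<Lambda> \<Gamma>"
      if \<Gamma>: "world \<Lambda> \<Gamma>" "world \<Lambda> \<Delta>" "s \<in> canonical_nbhds \<Lambda> \<Gamma>" "\<Delta> \<in> s" for \<Gamma> \<Delta> s
    proof -
      \<comment> \<open>\<Delta> inherits the conditionals of \<Gamma>, so its neighbourhoods meet
        all constraints that \<Gamma> imposes.\<close>
      have "(\<phi> \<Rrightarrow> \<psi>) \<in> \<Delta>" if "(\<phi> \<Rrightarrow> \<psi>) \<in> \<Gamma>" for \<phi> \<psi>
        by (rule member[OF schema[OF \<Gamma>(1) _ that] \<Gamma>(3,4,2)]) (simp add: Decreasingness)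
      then show ?thesis unfolding canonical_nbhds_def by blast
    qed
    then show ?thesis by (simp add: Decreasingness accessible_def) blast
  next
    case Increasingness
    have "canonical_nbhds \<Lambda> \<Gamma> \<subseteq> canonical_nbhds \<Lambda> \<Delta>"
      if \<Gamma>: "world \<Lambda> \<Gamma>" "world \<Lambda> \<Delta>" "s \<in> canonical_nbhds \<Lambda> \<Gamma>" "\<Delta> \<in> s" for \<Gamma> \<Delta> s
    proof -
      have "\<^bold>\<not> (\<phi> \<Rrightarrow> \<psi>) \<in> \<Delta>" if "\<^bold>\<not> (\<phi> \<Rrightarrow> \<psi>) \<in> \<Gamma>" for \<phi> \<psi>
        by (rule member[OF schema[OF \<Gamma>(1) _ that] \<Gamma>(3,4,2)]) (auto simp: Increasingness)
      \<comment> \<open>Read contrapositively, every conditional in \<Delta> is already in \<Gamma>,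
        so the neighbourhoods of \<Gamma> meet all constraints that \<Delta> imposes.\<close>
      then show ?thesis
        unfolding canonical_nbhds_def world_neg_iff[OF \<Gamma>(1)] world_neg_iff[OF \<Gamma>(2)] by blast
    qed
    then show ?thesis by (simp add: Increasingness accessible_def) blast
  qed
qed

section \<open>Completeness\<close>

text \<open>The counterexample is the state of worlds extending a prime theory that contains \<Phi>
  and omits \<psi>. Canonical worlds are sets of formulas, which fixes the type of worlds in the
  assumption.\<close>

lemma completeness:
  fixes \<Phi> :: "'p form set"
  assumes "entails TYPE('p form set) \<Lambda> \<Phi> \<psi>"
  shows "derives \<Lambda> \<Phi> \<psi>"
proof (rule ccontr)
  assume "\<not> derives \<Lambda> \<Phi> \<psi>"
  then have not_prov: "\<not> prov \<Lambda> \<Phi> \<psi>" by (simp add: prov_iff_derives)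
  interpret entailment \<Lambda> "\<lambda>\<phi> \<psi>. prov \<Lambda> (insert \<phi> \<Phi>) \<psi>" by (rule entailment_prov)
  have "\<not> prov \<Lambda> (insert \<^bold>\<top> \<Phi>) \<psi>"
    using not_prov by (simp add: prov_hyp_verum)
  then obtain T where T: "deductive_filter T" "\<^bold>\<top> \<in> T" "\<psi> \<notin> T"
    and prime: "\<And>\<chi> \<xi>. \<chi> \<^bold>\<squnion> \<xi> \<in> T \<Longrightarrow> \<chi> \<in> T \<or> \<xi> \<in> T"
    using prime_filter[of "{\<psi>}" "\<^bold>\<top>"] by auto
  let ?M = "canonical_model \<Lambda> :: ('p form set, 'p) in_model"
  let ?s = "{\<Gamma>. world \<Lambda> \<Gamma> \<and> T \<subseteq> \<Gamma>}"
  have s: "supports ?M ?s \<chi> \<longleftrightarrow> \<chi> \<in> T" for \<chi>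
    using msupports_prime[OF deductive_filter_closed[OF T(1)] prime]
    by (simp add: supports_canonical_model subset_iff)
  have "\<Phi> \<subseteq> T"
    using T(1,2) hyp unfolding deductive_filter_def by blast
  have "\<^bold>\<bottom> \<notin> T"
    using T(1,3) deductive_filter_closed prov_falsum[OF hyp] by blast
  \<comment> \<open>A nonempty state provides a world, as \<open>in_frame\<close> demands.\<close>
  then have "?s \<noteq> {}" using s[of "\<^bold>\<bottom>"] by simp
  then have "in_frame ?M"
    by (auto simp: in_frame_def canonical_nbhds_def)
  moreover have "?s \<subseteq> worlds ?M" by auto
  moreover have "\<forall>\<phi> \<in> \<Phi>. supports ?M ?s \<phi>" using s \<open>\<Phi> \<subseteq> T\<close> by blast
  ultimately have "supports ?M ?s \<psi>"
    using assms satisfies_canonical_model[of _ \<Lambda>] unfolding entails_def by blast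
  then show False using s T(3) by simp
qed

text \<open>Entailment over \<open>'p form set\<close> already yields derivability, and soundness
  holds over any type of worlds. Together the two conjuncts show that entailment over that one type
  implies entailment over every other.\<close>

theorem theorem7p1:
  fixes \<Lambda> :: "frame_condition set" and \<Phi> :: "'p form set" and \<psi> :: "'p form"
  shows "(derives \<Lambda> \<Phi> \<psi> \<longleftrightarrow> entails TYPE('p form set) \<Lambda> \<Phi> \<psi>)
    \<and> (derives \<Lambda> \<Phi> \<psi> \<longrightarrow> entails TYPE('w) \<Lambda> \<Phi> \<psi>)"
  by (intro conjI iffI impI; (rule soundness | rule completeness); assumption)

end
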